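(* For every double coset $\mathfrak g\in\mathbf K\setminus\mathbf G/\mathbf K$, the characteristic function $(Q,T)\mapsto\chi_{\mathfrak g}(Q,T)$ is a morphism of oriented graphs $$\Delta(\mathcal H\Join\mathcal H)\to\Delta(\mathcal V\oplus\mathcal V).$$
   Context: Let $p$ be a prime, $\alpha\ge 0$ and $k\ge 1$ integers. $\mathbf G=\mathrm{GL}(\alpha+k\infty,\mathbb Q_p)$ is the group of finitary ($g-1$ has finitely many nonzero entries) invertible block matrices over $\mathbb Q_p$ of size $\alpha+\infty+\dots+\infty$ ($k$ copies of $\infty=\mathbb N$). It is the union of the subgroups $\mathrm{GL}(\alpha+km,\mathbb Q_p)$, where in each of the $k$ infinite blocks only the first $m$ coordinates are involved. $\mathrm O(\infty,\mathbb Z_p)$ is the group of finitary infinite orthogonal matrices with entries in $\mathbb Z_p$, embedded in $\mathbf G$ by $\mathfrak I(u)=\mathrm{diag}(1_\alpha,u,\dots,u)$; its image is $\mathbf K$. A submodule means a $\mathbb Z_p$-submodule of a finite-dimensional $\mathbb Q_p$-space. Let $V$ carry a nondegenerate skew-symmetric bilinear form $B$. A submodule $R\subset V$ is isotropic if $B(v,w)\in\mathbb Z_p$ for all $v,w\in R$, and self-dual if it is maximal isotropic. A submodule $L\subset V$ is almost self-dual if it contains a self-dual submodule and $B(v,w)\in p^{-1}\mathbb Z_p$ for all $v,w\in L$. $\mathcal V=\mathbb Q_p^\alpha\oplus\mathbb Q_p^\alpha$ and $\mathcal H=\mathbb Q_p^k\oplus\mathbb Q_p^k$ carry the standard skew-symmetric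 forms with matrix $\begin{pmatrix}0&1\\ -1&0\end{pmatrix}$; $\mathcal V\oplus\mathcal V$ carries $B^\ominus(u\oplus v,u'\oplus v')=B_{\mathcal V}(u,u')-B_{\mathcal V}(v,v')$. Graphs: $\Delta(\mathcal V\oplus\mathcal V)$ has as vertices the almost self-dual submodules of $\mathcal V\oplus\mathcal V$, with an arrow from $R$ to a different vertex $R'$ if $R\supset R'$. $\Delta(\mathcal H\Join\mathcal H)$ has as vertices ordered pairs $(Q,T)$ of almost self-dual submodules of $\mathcal H$, with an arrow from $(Q,T)$ to a different vertex $(Q',T')$ if $Q\supset Q'$ and $T\supset T'$. A morphism of oriented graphs is a map $\sigma$ of vertex sets such that for any arrow $a\to b$ either $\sigma(a)=\sigma(b)$ or there is an arrow $\sigma(a)\to\sigma(b)$. A vector $x=(x_1^+,\dots,x_k^+,x_1^-,\dots,x_k^-)$ with $x_j^\pm\in\mathbb Q_p^m$ is regarded as an element of $\mathcal H\otimes\mathbb Q_p^m$; for a submodule $Q\subset\mathcal H$, $Q\otimes\mathbb Z_p^m$ is the direct sum of $m$ copies of $Q$, i.e. the set of $x$ such that for each $i=1,\dots,m$ the vector of $i$-th coordinates $(x_{1,i}^+,\dots,x_{k,i}^+,x_{1,i}^-,\dots,x_{k,i}^-)$ lies in $Q$. Characteristic function: let $g\in\mathrm{GL}(\alpha+km,\mathbb Q_p)$ represent the double coset $\mathfrak g$, and let $Q,T\subset\mathcal H$ be almost self-dual submodules. $\chi_{\mathfrak g}(Q,T)\subset\mathcal V\oplus\mathcal V$ is the set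 of all $u\oplus v$, $u=u^+\oplus u^-$, $v=v^+\oplus v^-$, for which there exist $x\in Q\otimes\mathbb Z_p^m$, $y\in T\otimes\mathbb Z_p^m$ with $$\begin{pmatrix}v^+\\ y^+\end{pmatrix}=g\begin{pmatrix}u^+\\ x^+\end{pmatrix},\qquad \begin{pmatrix}v^-\\ y^-\end{pmatrix}=(g^t)^{-1}\begin{pmatrix}u^-\\ x^-\end{pmatrix},$$ where $x^\pm=(x_1^\pm,\dots,x_k^\pm)$, $y^\pm=(y_1^\pm,\dots,y_k^\pm)$ are columns. It depends only on $\mathfrak g$, not on $m$ or the representative $g$. *)

theory Defs
  imports
    "HOL-Computational_Algebra.Fraction_Field"
    "HOL-Library.Groups_Big_Fun"
    "HOL-Library.Function_Algebras"
    "HOL-Algebra.Coset"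
    "Berlekamp_Zassenhaus.Finite_Field"
    "Graph_Theory.Pair_Digraph"
begin

section \<open>The \<open>p\<close>-adic numbers\<close>

text \<open>
  The prime \<open>p\<close> is \<^term>\<open>CARD('p)\<close> for a type \<open>'p\<close> of class \<^class>\<open>prime_card\<close>.
  The ring \<open>\<int>\<^sub>p\<close> is the inverse limit of the rings \<open>\<int>/p\<^sup>n\<close>: the defining equation
  forces \<open>0 \<le> x n < p\<^sup>n\<close>, so \<open>x n\<close> is the canonical representative of the \<open>n\<close>-th residue.
\<close>

typedef (overloaded) 'p padic_int =
  "{x :: nat \<Rightarrow> int. \<forall>n. x n = x (Suc n) mod int CARD('p::prime_card) ^ n}"
  by (rule exI[of _ "\<lambda>_. 0"]) simp

setup_lifting type_definition_padic_int

lemma mod_Suc_power: "(a mod q ^ Suc n) mod q ^ n = (a::int) mod q ^ n"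
  by (rule mod_mod_cancel) (simp add: le_imp_power_dvd)

lemma padic_trivial_mod:
  assumes "\<forall>n. x n = x (Suc n) mod q ^ n"
  shows "x n mod q ^ n = (x n :: int)"
proof -
  have "x n = x (Suc n) mod q ^ n" using assms by (rule spec)
  then show ?thesis by (metis mod_mod_trivial)
qed

lemma padic_step_mod:
  assumes "\<forall>n. x n = x (Suc n) mod q ^ n"
  shows "x n mod q ^ n = x (Suc n) mod (q :: int) ^ n"
  using assms spec[OF assms, of n] by (metis mod_mod_trivial)

instantiation padic_int :: (prime_card) comm_ring_1
begin

lift_definition zero_padic_int :: "'a padic_int" is "\<lambda>_. 0" by simp

lift_definition one_padic_int :: "'a padic_int" is "\<lambda>n. 1 mod int CARD('a) ^ n"
  unfolding mod_Suc_power by (intro allI refl)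

lift_definition plus_padic_int :: "'a padic_int \<Rightarrow> 'a padic_int \<Rightarrow> 'a padic_int"
  is "\<lambda>x y n. (x n + y n) mod int CARD('a) ^ n"
  unfolding mod_Suc_power by (intro allI mod_add_cong padic_step_mod)

lift_definition minus_padic_int :: "'a padic_int \<Rightarrow> 'a padic_int \<Rightarrow> 'a padic_int"
  is "\<lambda>x y n. (x n - y n) mod int CARD('a) ^ n"
  unfolding mod_Suc_power by (intro allI mod_diff_cong padic_step_mod)

lift_definition uminus_padic_int :: "'a padic_int \<Rightarrow> 'a padic_int"
  is "\<lambda>x n. (- x n) mod int CARD('a) ^ n"
  unfolding mod_Suc_power by (intro allI mod_minus_cong padic_step_mod)

lift_definition times_padic_int :: "'a padic_int \<Rightarrow> 'a padic_int \<Rightarrow> 'a padic_int"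
  is "\<lambda>x y n. (x n * y n) mod int CARD('a) ^ n"
  unfolding mod_Suc_power by (intro allI mod_mult_cong padic_step_mod)

instance
proof
  fix a b c :: "'a padic_int"
  show "a + b + c = a + (b + c)"
    by transfer (simp (no_asm) add: fun_eq_iff mod_simps add.assoc)
  show "a + b = b + a"
    by transfer (simp (no_asm) add: fun_eq_iff add.commute)
  show "0 + a = a"
    proof transfer
    fix a :: "nat \<Rightarrow> int"
    assume "\<forall>n. a n = a (Suc n) mod int CARD('a) ^ n"
    then have "a n mod int CARD('a) ^ n = a n" for n by (rule padic_trivial_mod)
    then show "(\<lambda>n. (0 + a n) mod int CARD('a) ^ n) = a" by simp
  qed
  show "- a + a = 0"
    by transfer (simp (no_asm) add: fun_eq_iff mod_simps)
  show "a - b = a + - b"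
    by transfer (simp (no_asm) add: fun_eq_iff mod_simps)
  show "a * b * c = a * (b * c)"
    by transfer (simp (no_asm) add: fun_eq_iff mod_simps mult.assoc)
  show "a * b = b * a"
    by transfer (simp (no_asm) add: fun_eq_iff mult.commute)
  show "1 * a = a"
    proof transfer
    fix a :: "nat \<Rightarrow> int"
    assume "\<forall>n. a n = a (Suc n) mod int CARD('a) ^ n"
    then have "a n mod int CARD('a) ^ n = a n" for n by (rule padic_trivial_mod)
    then show "(\<lambda>n. (1 mod int CARD('a) ^ n * a n) mod int CARD('a) ^ n) = a"
      by (simp add: mod_simps)
  qed
  show "(a + b) * c = a * c + b * c"
    by transfer (simp (no_asm) add: fun_eq_iff mod_simps distrib_right)
  show "(0::'a padic_int) \<noteq> 1"
  proof transfer
    have "prime (int CARD('a))" by (rule prime_card_int)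
    then have "1 mod int CARD('a) ^ 1 = 1"
      using prime_gt_1_int by auto
    then show "(\<lambda>_. 0) \<noteq> (\<lambda>n. 1 mod int CARD('a) ^ n)"
      by (metis zero_neq_one)
  qed
qed

end

instance padic_int :: (prime_card) idom
proof
  fix a b :: "'a padic_int"
  assume "a \<noteq> 0" "b \<noteq> 0"
  then show "a * b \<noteq> 0"
  proof transfer
    fix a b :: "nat \<Rightarrow> int"
    let ?p = "int CARD('a)"
    assume A: "\<forall>n. a n = a (Suc n) mod ?p ^ n" and B: "\<forall>n. b n = b (Suc n) mod ?p ^ n"
    assume "a \<noteq> (\<lambda>_. 0)" "b \<noteq> (\<lambda>_. 0)"
    then obtain r s where r: "a r \<noteq> 0" and s: "b s \<noteq> 0" by (auto simp: fun_eq_iff)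
    have up: "x (n + d) mod ?p ^ n = x n" if "\<forall>n. x n = x (Suc n) mod ?p ^ n" for x n d
    proof (induction d)
      case 0
      show ?case using padic_trivial_mod[OF that] by simp
    next
      case (Suc d)
      have "x (n + d) = x (Suc (n + d)) mod ?p ^ (n + d)" using that by (rule spec)
      then have "x (n + d) mod ?p ^ n = x (Suc (n + d)) mod ?p ^ (n + d) mod ?p ^ n"
        by (rule arg_cong)
      also have "\<dots> = x (Suc (n + d)) mod ?p ^ n"
        by (rule mod_mod_cancel) (simp add: le_imp_power_dvd)
      finally have "x (n + d) mod ?p ^ n = x (Suc (n + d)) mod ?p ^ n" .
      with Suc show ?case by simp
    qed
    have na: "\<not> ?p ^ r dvd a (r + s)" using up[OF A, of r s] r by (simp add: dvd_eq_mod_eq_0)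
    have nb: "\<not> ?p ^ s dvd b (r + s)" using up[OF B, of s r] s
      by (simp add: dvd_eq_mod_eq_0 add.commute)
    have p: "prime ?p" by (rule prime_card_int)
    have "\<not> ?p ^ (r + s) dvd a (r + s) * b (r + s)"
    proof
      assume dvd: "?p ^ (r + s) dvd a (r + s) * b (r + s)"
      have nz: "a (r + s) \<noteq> 0" "b (r + s) \<noteq> 0" using na nb by auto
      have "multiplicity ?p (a (r + s)) < r"
        using na by (meson multiplicity_dvd' not_less)
      moreover have "multiplicity ?p (b (r + s)) < s"
        using nb by (meson multiplicity_dvd' not_less)
      moreover have "r + s \<le> multiplicity ?p (a (r + s) * b (r + s))"
        using dvd nz p by (intro multiplicity_geI) (auto simp: prime_gt_1_int)
      ultimately show False
        using nz p by (simp add: prime_elem_multiplicity_mult_distrib)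
    qed
    then have "(a (r + s) * b (r + s)) mod ?p ^ (r + s) \<noteq> 0"
      by (simp add: dvd_eq_mod_eq_0)
    then show "(\<lambda>n. (a n * b n) mod ?p ^ n) \<noteq> (\<lambda>_. 0)"
      by metis
  qed
qed

type_synonym 'p padic = "'p padic_int fract"

definition of_padic_int :: "'p::prime_card padic_int \<Rightarrow> 'p padic" where
  "of_padic_int a = Fraction_Field.Fract a 1"

definition padic_ints :: "'p::prime_card padic set" (\<open>\<int>\<^sub>p\<close>) where
  "\<int>\<^sub>p = range of_padic_int"

section \<open>Submodules of spaces with a skew-symmetric form\<close>

text \<open>
  A finite-dimensional coordinate space is the set of all functions
  \<^typ>\<open>'i \<Rightarrow> 'p padic\<close> that vanish outside a finite set of coordinates; addition is pointwise.
  The direct sum \<open>u \<oplus> v\<close> of coordinate vectors is \<^term>\<open>case_sum u v\<close>, and the two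
  components of \<open>w\<close> are recovered as \<^term>\<open>w \<circ> Inl\<close> and \<^term>\<open>w \<circ> Inr\<close>.
\<close>

definition zp_scale :: "'p::prime_card padic_int \<Rightarrow> ('i \<Rightarrow> 'p padic) \<Rightarrow> 'i \<Rightarrow> 'p padic" where
  "zp_scale a v = (\<lambda>i. of_padic_int a * v i)"

definition zp_submodule :: "('i \<Rightarrow> 'p::prime_card padic) set \<Rightarrow> ('i \<Rightarrow> 'p padic) set \<Rightarrow> bool" where
  "zp_submodule V R \<longleftrightarrow> R \<subseteq> V \<and> Modules.module.subspace zp_scale R"

definition isotropic ::
  "('i \<Rightarrow> 'p::prime_card padic) set \<Rightarrow> (('i \<Rightarrow> 'p padic) \<Rightarrow> ('i \<Rightarrow> 'p padic) \<Rightarrow> 'p padic)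
    \<Rightarrow> ('i \<Rightarrow> 'p padic) set \<Rightarrow> bool" where
  "isotropic V B R \<longleftrightarrow> zp_submodule V R \<and> (\<forall>v\<in>R. \<forall>w\<in>R. B v w \<in> \<int>\<^sub>p)"

definition self_dual ::
  "('i \<Rightarrow> 'p::prime_card padic) set \<Rightarrow> (('i \<Rightarrow> 'p padic) \<Rightarrow> ('i \<Rightarrow> 'p padic) \<Rightarrow> 'p padic)
    \<Rightarrow> ('i \<Rightarrow> 'p padic) set \<Rightarrow> bool" where
  "self_dual V B R \<longleftrightarrow>
    isotropic V B R \<and> (\<forall>R'. isotropic V B R' \<and> R \<subseteq> R' \<longrightarrow> R' = R)"

definition almost_self_dual ::
  "('i \<Rightarrow> 'p::prime_card padic) set \<Rightarrow> (('i \<Rightarrow> 'p padic) \<Rightarrow> ('i \<Rightarrow> 'p padic) \<Rightarrow> 'p padic)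
    \<Rightarrow> ('i \<Rightarrow> 'p padic) set \<Rightarrow> bool" where
  "almost_self_dual V B L \<longleftrightarrow>
    zp_submodule V L \<and> (\<exists>R\<subseteq>L. self_dual V B R) \<and>
    (\<forall>v\<in>L. \<forall>w\<in>L. B v w \<in> {z / of_nat CARD('p) | z. z \<in> \<int>\<^sub>p})"

text \<open>
  \<open>\<rat>\<^sub>p\<^sup>n \<oplus> \<rat>\<^sub>p\<^sup>n\<close> with its standard form; this is \<open>\<V>\<close> for \<open>n = \<alpha>\<close>
  and \<open>\<H>\<close> for \<open>n = k\<close>.
\<close>

definition std_space :: "nat \<Rightarrow> (nat + nat \<Rightarrow> 'p::prime_card padic) set" where
  "std_space n = {v. \<forall>i\<ge>n. v (Inl i) = 0 \<and> v (Inr i) = 0}"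

definition std_form ::
  "nat \<Rightarrow> (nat + nat \<Rightarrow> 'p::prime_card padic) \<Rightarrow> (nat + nat \<Rightarrow> 'p padic) \<Rightarrow> 'p padic" where
  "std_form n v w = (\<Sum>i<n. v (Inl i) * w (Inr i) - v (Inr i) * w (Inl i))"

definition dbl_space :: "nat \<Rightarrow> ((nat + nat) + (nat + nat) \<Rightarrow> 'p::prime_card padic) set" where
  "dbl_space n = {case_sum u v | u v. u \<in> std_space n \<and> v \<in> std_space n}"

definition dbl_form ::
  "nat \<Rightarrow> ((nat + nat) + (nat + nat) \<Rightarrow> 'p::prime_card padic)
    \<Rightarrow> ((nat + nat) + (nat + nat) \<Rightarrow> 'p padic) \<Rightarrow> 'p padic" where
  "dbl_form n w w' = std_form n (w \<circ> Inl) (w' \<circ> Inl) - std_form n (w \<circ> Inr) (w' \<circ> Inr)"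

section \<open>Oriented graphs\<close>

definition graph_morphism :: "'a pair_pre_digraph \<Rightarrow> 'b pair_pre_digraph \<Rightarrow> ('a \<Rightarrow> 'b) \<Rightarrow> bool" where
  "graph_morphism \<Gamma> \<Gamma>' \<sigma> \<longleftrightarrow>
    \<sigma> \<in> pverts \<Gamma> \<rightarrow> pverts \<Gamma>' \<and>
    (\<forall>(a, b)\<in>parcs \<Gamma>. \<sigma> a = \<sigma> b \<or> (\<sigma> a, \<sigma> b) \<in> parcs \<Gamma>')"

definition graph_VV ::
  "nat \<Rightarrow> ((nat + nat) + (nat + nat) \<Rightarrow> 'p::prime_card padic) set pair_pre_digraph" where
  "graph_VV \<alpha> = (let W = {R. almost_self_dual (dbl_space \<alpha>) (dbl_form \<alpha>) R} in
    \<lparr>pverts = W, parcs = {(R, R'). R \<in> W \<and> R' \<in> W \<and> R \<noteq> R' \<and> R' \<subseteq> R}\<rparr>)"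

definition graph_HH ::
  "nat \<Rightarrow> ((nat + nat \<Rightarrow> 'p::prime_card padic) set \<times> (nat + nat \<Rightarrow> 'p padic) set) pair_pre_digraph"
  where
  "graph_HH k = (let W = {R. almost_self_dual (std_space k) (std_form k) R} in
    \<lparr>pverts = W \<times> W,
     parcs = {((Q, T), (Q', T')). Q \<in> W \<and> T \<in> W \<and> Q' \<in> W \<and> T' \<in> W \<and>
       (Q, T) \<noteq> (Q', T') \<and> Q' \<subseteq> Q \<and> T' \<subseteq> T}\<rparr>)"

section \<open>Finitary matrices and the groups\<close>

text \<open>
  Row and column indices of a block matrix of size \<open>\<alpha> + \<infinity> + \<dots> + \<infinity>\<close>: \<^term>\<open>Inl i\<close> with
  \<open>i < \<alpha>\<close> is the \<open>i\<close>-th index of the first block, \<^term>\<open>Inr (j, n)\<close> with \<open>j < k\<close> is the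
  \<open>n\<close>-th index of the \<open>j\<close>-th infinite block. A matrix is a function on all pairs of
  indices that agrees with the identity matrix off the indices of this form.
  For a finitary matrix all the sums below have finite support.
\<close>

type_synonym idx = "nat + nat \<times> nat"

definition kron :: "'i \<Rightarrow> 'i \<Rightarrow> 'p::prime_card padic" where
  "kron a b = (if a = b then 1 else 0)"

definition mat_mult ::
  "('i \<Rightarrow> 'i \<Rightarrow> 'p::prime_card padic) \<Rightarrow> ('i \<Rightarrow> 'i \<Rightarrow> 'p padic) \<Rightarrow> 'i \<Rightarrow> 'i \<Rightarrow> 'p padic" where
  "mat_mult g h = (\<lambda>a b. Sum_any (\<lambda>c. g a c * h c b))"

definition mat_vec ::
  "('i \<Rightarrow> 'i \<Rightarrow> 'p::prime_card padic) \<Rightarrow> ('i \<Rightarrow> 'p padic) \<Rightarrow> 'i \<Rightarrow> 'p padic" where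
  "mat_vec g w = (\<lambda>a. Sum_any (\<lambda>c. g a c * w c))"

definition mat_transpose :: "('i \<Rightarrow> 'i \<Rightarrow> 'p::prime_card padic) \<Rightarrow> 'i \<Rightarrow> 'i \<Rightarrow> 'p padic" where
  "mat_transpose g = (\<lambda>a b. g b a)"

definition nontriv_entries :: "('i \<Rightarrow> 'i \<Rightarrow> 'p::prime_card padic) \<Rightarrow> ('i \<times> 'i) set" where
  "nontriv_entries g = {(a, b). g a b \<noteq> kron a b}"

definition idx_all :: "nat \<Rightarrow> nat \<Rightarrow> idx set" where
  "idx_all \<alpha> k = Inl ` {..<\<alpha>} \<union> Inr ` ({..<k} \<times> UNIV)"

definition idx_upto :: "nat \<Rightarrow> nat \<Rightarrow> nat \<Rightarrow> idx set" where
  "idx_upto \<alpha> k m = Inl ` {..<\<alpha>} \<union> Inr ` ({..<k} \<times> {..<m})"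

definition finitary_monoid :: "nat \<Rightarrow> nat \<Rightarrow> (idx \<Rightarrow> idx \<Rightarrow> 'p::prime_card padic) monoid" where
  "finitary_monoid \<alpha> k =
    \<lparr>carrier = {g. finite (nontriv_entries g) \<and> nontriv_entries g \<subseteq> idx_all \<alpha> k \<times> idx_all \<alpha> k},
     monoid.mult = mat_mult, one = kron\<rparr>"

definition GL_inf :: "nat \<Rightarrow> nat \<Rightarrow> (idx \<Rightarrow> idx \<Rightarrow> 'p::prime_card padic) monoid" where
  "GL_inf \<alpha> k = units_of (finitary_monoid \<alpha> k)"

definition GL_fin :: "nat \<Rightarrow> nat \<Rightarrow> nat \<Rightarrow> (idx \<Rightarrow> idx \<Rightarrow> 'p::prime_card padic) set" where
  "GL_fin \<alpha> k m =
    {g \<in> carrier (GL_inf \<alpha> k). nontriv_entries g \<subseteq> idx_upto \<alpha> k m \<times> idx_upto \<alpha> k m}"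

definition O_inf :: "(nat \<Rightarrow> nat \<Rightarrow> 'p::prime_card padic) set" where
  "O_inf = {u. finite (nontriv_entries u) \<and> (\<forall>i j. u i j \<in> \<int>\<^sub>p) \<and>
     mat_mult u (mat_transpose u) = kron \<and> mat_mult (mat_transpose u) u = kron}"

definition block_diag :: "nat \<Rightarrow> (nat \<Rightarrow> nat \<Rightarrow> 'p::prime_card padic) \<Rightarrow> idx \<Rightarrow> idx \<Rightarrow> 'p padic" where
  "block_diag k u a b =
    (case (a, b) of
       (Inr (j, n), Inr (j', n')) \<Rightarrow> if j = j' \<and> j < k then u n n' else kron a b
     | _ \<Rightarrow> kron a b)"

definition K_sub :: "nat \<Rightarrow> (idx \<Rightarrow> idx \<Rightarrow> 'p::prime_card padic) set" where
  "K_sub k = block_diag k ` O_inf"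

definition double_cosets :: "nat \<Rightarrow> nat \<Rightarrow> (idx \<Rightarrow> idx \<Rightarrow> 'p::prime_card padic) set set" where
  "double_cosets \<alpha> k =
    {(K_sub k #>\<^bsub>GL_inf \<alpha> k\<^esub> g) <#>\<^bsub>GL_inf \<alpha> k\<^esub> K_sub k | g. g \<in> carrier (GL_inf \<alpha> k)}"

section \<open>The characteristic function\<close>

text \<open>
  A vector \<open>x\<close> of \<open>\<H> \<otimes> \<rat>\<^sub>p\<^sup>m\<close> has coordinates \<open>x\<^sup>+\<^bsub>j,i\<^esub> =\<close> \<^term>\<open>x (Inl (j, i))\<close> and
  \<open>x\<^sup>-\<^bsub>j,i\<^esub> =\<close> \<^term>\<open>x (Inr (j, i))\<close>, which are \<open>0\<close> unless \<open>j < k\<close> and \<open>i < m\<close>.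
\<close>

definition slice :: "nat \<Rightarrow> (nat \<times> nat + nat \<times> nat \<Rightarrow> 'p::prime_card padic) \<Rightarrow> nat + nat \<Rightarrow> 'p padic"
  where "slice i x = case_sum (\<lambda>j. x (Inl (j, i))) (\<lambda>j. x (Inr (j, i)))"

definition tensor_Zp ::
  "nat \<Rightarrow> (nat + nat \<Rightarrow> 'p::prime_card padic) set \<Rightarrow> (nat \<times> nat + nat \<times> nat \<Rightarrow> 'p padic) set" where
  "tensor_Zp m Q = {x. (\<forall>i<m. slice i x \<in> Q) \<and> (\<forall>i\<ge>m. slice i x = 0)}"

definition chi_rep ::
  "nat \<Rightarrow> nat \<Rightarrow> nat \<Rightarrow> (idx \<Rightarrow> idx \<Rightarrow> 'p::prime_card padic)
    \<Rightarrow> (nat + nat \<Rightarrow> 'p padic) set \<Rightarrow> (nat + nat \<Rightarrow> 'p padic) set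
    \<Rightarrow> ((nat + nat) + (nat + nat) \<Rightarrow> 'p padic) set" where
  "chi_rep \<alpha> k m g Q T =
    {case_sum u v | u v. u \<in> std_space \<alpha> \<and> v \<in> std_space \<alpha> \<and>
      (\<exists>x\<in>tensor_Zp m Q. \<exists>y\<in>tensor_Zp m T.
        case_sum (v \<circ> Inl) (y \<circ> Inl) = mat_vec g (case_sum (u \<circ> Inl) (x \<circ> Inl)) \<and>
        case_sum (v \<circ> Inr) (y \<circ> Inr) =
          mat_vec (inv\<^bsub>GL_inf \<alpha> k\<^esub> (mat_transpose g)) (case_sum (u \<circ> Inr) (x \<circ> Inr)))}"

text \<open>
  The choice of \<open>m\<close> and of the representative is immaterial, see \<open>chi_eq_chi_rep\<close> below.
\<close>

definition chi ::
  "nat \<Rightarrow> nat \<Rightarrow> (idx \<Rightarrow> idx \<Rightarrow> 'p::prime_card padic) set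
    \<Rightarrow> (nat + nat \<Rightarrow> 'p padic) set \<Rightarrow> (nat + nat \<Rightarrow> 'p padic) set
    \<Rightarrow> ((nat + nat) + (nat + nat) \<Rightarrow> 'p padic) set" where
  "chi \<alpha> k \<gg> Q T =
    (let (m, g) = (SOME (m, g). g \<in> \<gg> \<and> g \<in> GL_fin \<alpha> k m) in chi_rep \<alpha> k m g Q T)"

section \<open>The characteristic function is well defined\<close>

lemma of_padic_int_hom:
  "of_padic_int (a + b) = of_padic_int a + of_padic_int b"
  "of_padic_int (a * b) = of_padic_int a * of_padic_int b"
  "of_padic_int 1 = 1"
  by (simp_all add: of_padic_int_def One_fract_def)

lemma module_zp_scale:
  "Modules.module (zp_scale :: 'p::prime_card padic_int \<Rightarrow> ('i \<Rightarrow> 'p padic) \<Rightarrow> _)"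
  by unfold_locales (auto simp: zp_scale_def of_padic_int_hom fun_eq_iff algebra_simps)

lemma zp_submodule_sum:
  assumes "zp_submodule V R" "\<And>i. i \<in> N \<Longrightarrow> f i \<in> R"
  shows "sum f N \<in> R"
  using assms unfolding zp_submodule_def by (auto intro: Modules.module.subspace_sum[OF module_zp_scale])

lemma zp_submodule_scale:
  assumes "zp_submodule V R" "f \<in> R" "c \<in> \<int>\<^sub>p"
  shows "(\<lambda>i. c * f i) \<in> R"
proof -
  obtain a where "c = of_padic_int a" using assms(3) by (auto simp: padic_ints_def)
  then have "(\<lambda>i. c * f i) = zp_scale a f" by (simp add: zp_scale_def)
  then show ?thesis
    using assms unfolding zp_submodule_def by (auto intro: Modules.module.subspace_scale[OF module_zp_scale])
qed

lemma zp_submodule_0: "zp_submodule V R \<Longrightarrow> 0 \<in> R"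
  unfolding zp_submodule_def by (auto intro: Modules.module.subspace_0[OF module_zp_scale])

abbreviation "supported J g \<equiv> nontriv_entries g \<subseteq> J \<times> J"

lemma supportedD:
  assumes "supported J g" "a \<notin> J \<or> b \<notin> J" shows "g a b = kron a b"
  using assms by (auto simp: nontriv_entries_def)

lemma mat_vec_eq:
  assumes "finite J" "supported J g"
  shows "mat_vec g w a = (if a \<in> J then \<Sum>c\<in>J. g a c * w c else w a)"
proof (cases "a \<in> J")
  case True
  have "g a c = 0" if "c \<notin> J" for c
    using supportedD[OF assms(2), of a c] True that by (auto simp: kron_def)
  then have "{c. g a c * w c \<noteq> 0} \<subseteq> J" by auto
  then show ?thesis
    using True assms(1) by (simp add: mat_vec_def Sum_any.expand_superset)
next
  case False
  then have "g a c * w c = (if c = a then w c else 0)" for c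
    using supportedD[OF assms(2), of a c] by (simp add: kron_def)
  then show ?thesis using False by (simp add: mat_vec_def)
qed

lemma mat_mult_col: "mat_mult g h a b = mat_vec g (\<lambda>c. h c b) a"
  by (simp add: mat_mult_def mat_vec_def)

lemma mat_vec_col: "mat_vec kron w = w"
  by (rule ext) (simp add: mat_vec_def kron_def if_distrib[of "\<lambda>x. x * _"] eq_commute[of _ "_::'a"] cong: if_cong)

lemma supported_mult:
  assumes "finite J" "supported J g" "supported J h" shows "supported J (mat_mult g h)"
proof -
  have "mat_mult g h a b = kron a b" if "a \<notin> J \<or> b \<notin> J" for a b
  proof (cases "a \<in> J")
    case True
    then have b: "b \<notin> J" using that by blast
    have "(\<Sum>c\<in>J. g a c * h c b) = 0"
      using b supportedD[OF assms(3), of _ b] by (intro sum.neutral) (auto simp: kron_def)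
    then show ?thesis
      using True b by (auto simp: mat_mult_col mat_vec_eq[OF assms(1,2)] kron_def)
  next
    case False
    then show ?thesis
      using supportedD[OF assms(3), of a b] by (simp add: mat_mult_col mat_vec_eq[OF assms(1,2)])
  qed
  then show ?thesis by (auto simp: nontriv_entries_def)
qed

lemma mat_vec_mult:
  assumes J: "finite J" and g: "supported J g" and h: "supported J h"
  shows "mat_vec (mat_mult g h) w = mat_vec g (mat_vec h w)"
proof
  fix a
  show "mat_vec (mat_mult g h) w a = mat_vec g (mat_vec h w) a"
  proof (cases "a \<in> J")
    case True
    have "mat_vec (mat_mult g h) w a = (\<Sum>b\<in>J. (\<Sum>c\<in>J. g a c * h c b) * w b)"
      using True by (simp add: mat_vec_eq[OF J supported_mult[OF J g h]] mat_mult_col mat_vec_eq[OF J g])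
    also have "\<dots> = (\<Sum>b\<in>J. \<Sum>c\<in>J. g a c * (h c b * w b))"
      by (simp add: sum_distrib_right mult.assoc)
    also have "\<dots> = (\<Sum>c\<in>J. \<Sum>b\<in>J. g a c * (h c b * w b))"
      by (rule sum.swap)
    also have "\<dots> = mat_vec g (mat_vec h w) a"
      using True by (simp add: mat_vec_eq[OF J g] mat_vec_eq[OF J h] sum_distrib_left)
    finally show ?thesis .
  next
    case False
    then show ?thesis
      by (simp add: mat_vec_eq[OF J supported_mult[OF J g h]] mat_vec_eq[OF J g] mat_vec_eq[OF J h])
  qed
qed

lemma mat_mult_assoc:
  assumes "finite J" "supported J g" "supported J h"
  shows "mat_mult (mat_mult g h) l = mat_mult g (mat_mult h l)"
  by (intro ext) (simp add: mat_mult_col[abs_def] mat_vec_mult[OF assms, unfolded mat_mult_col[abs_def]])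

lemma mat_mult_kron_left: "mat_mult kron g = g"
  by (intro ext) (simp add: mat_mult_col mat_vec_col)

lemma mat_mult_kron_right: "mat_mult g kron = g"
  by (intro ext) (simp add: mat_mult_def kron_def if_distrib[of "\<lambda>x. _ * x"] cong: if_cong)

lemma mat_transpose_mult:
  "mat_transpose (mat_mult g h) = mat_mult (mat_transpose h) (mat_transpose g)"
  by (intro ext) (simp add: mat_transpose_def mat_mult_def mult.commute)

lemma mat_transpose_transpose [simp]: "mat_transpose (mat_transpose g) = g"
  by (simp add: mat_transpose_def)

lemma mat_transpose_kron [simp]: "mat_transpose kron = kron"
  by (intro ext) (simp add: mat_transpose_def kron_def)

lemma supported_transpose: "supported J g \<Longrightarrow> supported J (mat_transpose g)"
proof
  fix z assume s: "supported J g" and "z \<in> nontriv_entries (mat_transpose g)"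
  then obtain a b where z: "z = (a, b)" and "g b a \<noteq> kron a b"
    by (auto simp: nontriv_entries_def mat_transpose_def)
  then have "(b, a) \<in> nontriv_entries g" by (auto simp: nontriv_entries_def kron_def)
  then show "z \<in> J \<times> J" using s z by blast
qed

lemma supported_mono: "supported J g \<Longrightarrow> J \<subseteq> J' \<Longrightarrow> supported J' g"
  by blast

lemma finite_idx_upto [simp]: "finite (idx_upto \<alpha> k m)"
  by (simp add: idx_upto_def)

lemma idx_upto_mono: "m \<le> m' \<Longrightarrow> idx_upto \<alpha> k m \<subseteq> idx_upto \<alpha> k m'"
  by (auto simp: idx_upto_def)

lemma idx_upto_subset: "idx_upto \<alpha> k m \<subseteq> idx_all \<alpha> k"
  by (auto simp: idx_upto_def idx_all_def)

lemma finite_subset_idx_upto: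
  assumes "finite A" "A \<subseteq> idx_all \<alpha> k" shows "\<exists>m. A \<subseteq> idx_upto \<alpha> k m"
  using assms
proof (induction A)
  case empty
  show ?case by simp
next
  case (insert a A)
  then obtain m where m: "A \<subseteq> idx_upto \<alpha> k m" by blast
  obtain m' where "a \<in> idx_upto \<alpha> k m'"
    using insert.prems by (auto simp: idx_all_def idx_upto_def image_iff)
  then have "insert a A \<subseteq> idx_upto \<alpha> k (max m m')"
    using m idx_upto_mono[of m "max m m'" \<alpha> k] idx_upto_mono[of m' "max m m'" \<alpha> k] by auto
  then show ?case by blast
qed

lemma finitary_carrier_iff:
  "g \<in> carrier (finitary_monoid \<alpha> k) \<longleftrightarrow> (\<exists>m. supported (idx_upto \<alpha> k m) g)"
proof
  assume "g \<in> carrier (finitary_monoid \<alpha> k)"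
  then have f: "finite (nontriv_entries g)" and s: "nontriv_entries g \<subseteq> idx_all \<alpha> k \<times> idx_all \<alpha> k"
    by (auto simp: finitary_monoid_def)
  then obtain m where "fst ` nontriv_entries g \<union> snd ` nontriv_entries g \<subseteq> idx_upto \<alpha> k m"
    using finite_subset_idx_upto[of "fst ` nontriv_entries g \<union> snd ` nontriv_entries g" \<alpha> k] by force
  then have "supported (idx_upto \<alpha> k m) g" by force
  then show "\<exists>m. supported (idx_upto \<alpha> k m) g" ..
next
  assume "\<exists>m. supported (idx_upto \<alpha> k m) g"
  then obtain m where m: "supported (idx_upto \<alpha> k m) g" ..
  then have "finite (nontriv_entries g)" by (rule finite_subset) simp
  then show "g \<in> carrier (finitary_monoid \<alpha> k)"
    using m idx_upto_subset[of \<alpha> k m] by (fastforce simp: finitary_monoid_def)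
qed

lemma common_support:
  assumes "supported (idx_upto \<alpha> k m) g" "supported (idx_upto \<alpha> k m') h"
  shows "supported (idx_upto \<alpha> k (max m m')) g" "supported (idx_upto \<alpha> k (max m m')) h"
  using assms idx_upto_mono[of m "max m m'" \<alpha> k] idx_upto_mono[of m' "max m m'" \<alpha> k] by auto

lemma common_support_ex:
  assumes "g \<in> carrier (finitary_monoid \<alpha> k)" "h \<in> carrier (finitary_monoid \<alpha> k)"
  shows "\<exists>J. finite J \<and> supported J g \<and> supported J h \<and> (\<exists>m. J = idx_upto \<alpha> k m)"
  using assms common_support finite_idx_upto unfolding finitary_carrier_iff by metis

lemma finitary_simps [simp]:
  "g \<otimes>\<^bsub>finitary_monoid \<alpha> k\<^esub> h = mat_mult g h" "\<one>\<^bsub>finitary_monoid \<alpha> k\<^esub> = kron"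
  by (simp_all add: finitary_monoid_def)

lemma monoid_finitary:
  "Group.monoid (finitary_monoid \<alpha> k :: (idx \<Rightarrow> idx \<Rightarrow> 'p::prime_card padic) monoid)"
proof
  fix g h l :: "idx \<Rightarrow> idx \<Rightarrow> 'p padic"
  assume g: "g \<in> carrier (finitary_monoid \<alpha> k)" and h: "h \<in> carrier (finitary_monoid \<alpha> k)"
  obtain J where J: "finite J" "supported J g" "supported J h" and "\<exists>m. J = idx_upto \<alpha> k m"
    using common_support_ex[OF g h] by blast
  then show "g \<otimes>\<^bsub>finitary_monoid \<alpha> k\<^esub> h \<in> carrier (finitary_monoid \<alpha> k)"
    using supported_mult[OF J] unfolding finitary_carrier_iff by auto
  show "g \<otimes>\<^bsub>finitary_monoid \<alpha> k\<^esub> h \<otimes>\<^bsub>finitary_monoid \<alpha> k\<^esub> l =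
    g \<otimes>\<^bsub>finitary_monoid \<alpha> k\<^esub> (h \<otimes>\<^bsub>finitary_monoid \<alpha> k\<^esub> l)"
    using mat_mult_assoc[OF J] by simp
next
  show "\<one>\<^bsub>finitary_monoid \<alpha> k\<^esub> \<in> carrier (finitary_monoid \<alpha> k)"
    by (simp add: finitary_carrier_iff nontriv_entries_def)
qed (simp_all add: mat_mult_kron_left mat_mult_kron_right)

lemma group_GL_inf: "Group.group (GL_inf \<alpha> k)"
  unfolding GL_inf_def by (rule monoid.units_group[OF monoid_finitary])

lemma GL_inf_simps [simp]:
  "g \<otimes>\<^bsub>GL_inf \<alpha> k\<^esub> h = mat_mult g h" "\<one>\<^bsub>GL_inf \<alpha> k\<^esub> = kron"
  by (simp_all add: GL_inf_def units_of_def)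

lemma GL_inf_carrier_iff:
  "g \<in> carrier (GL_inf \<alpha> k) \<longleftrightarrow> g \<in> carrier (finitary_monoid \<alpha> k) \<and>
    (\<exists>h\<in>carrier (finitary_monoid \<alpha> k). mat_mult g h = kron \<and> mat_mult h g = kron)"
  by (auto simp: GL_inf_def units_of_def Units_def)

lemma GL_inf_finitary: "g \<in> carrier (GL_inf \<alpha> k) \<Longrightarrow> g \<in> carrier (finitary_monoid \<alpha> k)"
  by (simp add: GL_inf_carrier_iff)

lemma GL_inf_transpose:
  assumes "g \<in> carrier (GL_inf \<alpha> k)" shows "mat_transpose g \<in> carrier (GL_inf \<alpha> k)"
proof -
  obtain h where h: "h \<in> carrier (finitary_monoid \<alpha> k)" "mat_mult g h = kron" "mat_mult h g = kron"
    using assms by (auto simp: GL_inf_carrier_iff)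
  have "mat_mult (mat_transpose g) (mat_transpose h) = kron"
    "mat_mult (mat_transpose h) (mat_transpose g) = kron"
    using h by (simp_all flip: mat_transpose_mult)
  moreover have "mat_transpose g \<in> carrier (finitary_monoid \<alpha> k)"
    "mat_transpose h \<in> carrier (finitary_monoid \<alpha> k)"
    using h(1) GL_inf_finitary[OF assms] supported_transpose unfolding finitary_carrier_iff by blast+
  ultimately show ?thesis unfolding GL_inf_carrier_iff by blast
qed

lemma mat_vec_mult_GL:
  assumes "g \<in> carrier (GL_inf \<alpha> k)" "h \<in> carrier (GL_inf \<alpha> k)"
  shows "mat_vec (mat_mult g h) w = mat_vec g (mat_vec h w)"
  using common_support_ex[OF GL_inf_finitary[OF assms(1)] GL_inf_finitary[OF assms(2)]] mat_vec_mult
  by blast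

lemma mat_vec_inv_iff:
  assumes g: "g \<in> carrier (GL_inf \<alpha> k)"
  shows "w = mat_vec (inv\<^bsub>GL_inf \<alpha> k\<^esub> g) z \<longleftrightarrow> mat_vec g w = z"
proof -
  interpret Group.group "GL_inf \<alpha> k" by (rule group_GL_inf)
  have 1: "mat_vec g (mat_vec (inv\<^bsub>GL_inf \<alpha> k\<^esub> g) z) = z" for z
    using mat_vec_mult_GL[OF g inv_closed[OF g], of z] r_inv[OF g] by (simp add: mat_vec_col)
  have 2: "mat_vec (inv\<^bsub>GL_inf \<alpha> k\<^esub> g) (mat_vec g w) = w" for w
    using mat_vec_mult_GL[OF inv_closed[OF g] g, of w] l_inv[OF g] by (simp add: mat_vec_col)
  show ?thesis using 1 2 by metis
qed

definition chi_all ::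
  "nat \<Rightarrow> (idx \<Rightarrow> idx \<Rightarrow> 'p::prime_card padic)
    \<Rightarrow> (nat + nat \<Rightarrow> 'p padic) set \<Rightarrow> (nat + nat \<Rightarrow> 'p padic) set
    \<Rightarrow> ((nat + nat) + (nat + nat) \<Rightarrow> 'p padic) set" where
  "chi_all \<alpha> g Q T =
    {case_sum u v | u v. u \<in> std_space \<alpha> \<and> v \<in> std_space \<alpha> \<and>
      (\<exists>x y. (\<forall>i. slice i x \<in> Q) \<and> (\<forall>i. slice i y \<in> T) \<and>
        case_sum (v \<circ> Inl) (y \<circ> Inl) = mat_vec g (case_sum (u \<circ> Inl) (x \<circ> Inl)) \<and>
        mat_vec (mat_transpose g) (case_sum (v \<circ> Inr) (y \<circ> Inr)) =
          case_sum (u \<circ> Inr) (x \<circ> Inr))}"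

definition trunc :: "nat \<Rightarrow> (nat \<times> nat + nat \<times> nat \<Rightarrow> 'p::prime_card padic) \<Rightarrow> _" where
  "trunc m x = case_sum (\<lambda>(j, i). if i < m then x (Inl (j, i)) else 0)
                        (\<lambda>(j, i). if i < m then x (Inr (j, i)) else 0)"

lemma slice_trunc: "slice i (trunc m x) = (if i < m then slice i x else 0)"
  by (auto simp: slice_def trunc_def fun_eq_iff split: sum.splits)

lemma mat_vec_trunc:
  assumes g: "supported (idx_upto \<alpha> k m) g"
    and eq: "case_sum v y = mat_vec g (case_sum u x)"
  shows "case_sum v (\<lambda>(j, i). if i < m then y (j, i) else 0) =
    mat_vec g (case_sum u (\<lambda>(j, i). if i < m then x (j, i) else 0))"
proof
  fix a
  let ?J = "idx_upto \<alpha> k m"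
  let ?x = "\<lambda>(j, i). if i < m then x (j, i) else 0"
  note mv = mat_vec_eq[OF finite_idx_upto g]
  have *: "(\<Sum>c\<in>?J. g a c * case_sum u ?x c) = (\<Sum>c\<in>?J. g a c * case_sum u x c)"
    by (rule sum.cong) (auto simp: idx_upto_def)
  have e: "case_sum v y a = mat_vec g (case_sum u x) a" using eq by simp
  show "case_sum v (\<lambda>(j, i). if i < m then y (j, i) else 0) a = mat_vec g (case_sum u ?x) a"
  proof (cases "a \<in> ?J")
    case True
    then show ?thesis using e * by (auto simp: mv idx_upto_def)
  next
    case False
    then show ?thesis using e by (auto simp: mv split: sum.splits)
  qed
qed

lemma chi_rep_eq_chi_all:
  fixes g :: "idx \<Rightarrow> idx \<Rightarrow> 'p::prime_card padic"
  assumes g: "g \<in> GL_fin \<alpha> k m" and Q: "zp_submodule (std_space k) Q" and T: "zp_submodule (std_space k) T"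
  shows "chi_rep \<alpha> k m g Q T = chi_all \<alpha> g Q T"
proof -
  have gG: "g \<in> carrier (GL_inf \<alpha> k)" and gs: "supported (idx_upto \<alpha> k m) g"
    using g by (auto simp: GL_fin_def)
  have iff: "case_sum (v \<circ> Inr) (y \<circ> Inr) =
      mat_vec (inv\<^bsub>GL_inf \<alpha> k\<^esub> (mat_transpose g)) (case_sum (u \<circ> Inr) (x \<circ> Inr)) \<longleftrightarrow>
      mat_vec (mat_transpose g) (case_sum (v \<circ> Inr) (y \<circ> Inr)) = case_sum (u \<circ> Inr) (x \<circ> Inr)"
    for u v :: "nat + nat \<Rightarrow> 'p padic" and x y :: "nat \<times> nat + nat \<times> nat \<Rightarrow> 'p padic"
    by (rule mat_vec_inv_iff[OF GL_inf_transpose[OF gG]])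
  have 1: "\<exists>x\<in>tensor_Zp m Q. \<exists>y\<in>tensor_Zp m T.
        case_sum (v \<circ> Inl) (y \<circ> Inl) = mat_vec g (case_sum (u \<circ> Inl) (x \<circ> Inl)) \<and>
        mat_vec (mat_transpose g) (case_sum (v \<circ> Inr) (y \<circ> Inr)) = case_sum (u \<circ> Inr) (x \<circ> Inr)"
    if "\<forall>i. slice i x \<in> Q" "\<forall>i. slice i y \<in> T"
      and p: "case_sum (v \<circ> Inl) (y \<circ> Inl) = mat_vec g (case_sum (u \<circ> Inl) (x \<circ> Inl))"
      and q: "mat_vec (mat_transpose g) (case_sum (v \<circ> Inr) (y \<circ> Inr)) =
          case_sum (u \<circ> Inr) (x \<circ> Inr)"
    for u v and x y :: "nat \<times> nat + nat \<times> nat \<Rightarrow> 'p padic"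
  proof (intro bexI conjI)
    have tl: "trunc m z \<circ> Inl = (\<lambda>(j, i). if i < m then (z \<circ> Inl) (j, i) else 0)"
      and tr: "trunc m z \<circ> Inr = (\<lambda>(j, i). if i < m then (z \<circ> Inr) (j, i) else 0)"
      for z :: "nat \<times> nat + nat \<times> nat \<Rightarrow> 'p padic"
      by (auto simp: trunc_def fun_eq_iff)
    show "trunc m x \<in> tensor_Zp m Q" "trunc m y \<in> tensor_Zp m T"
      using that by (auto simp: tensor_Zp_def slice_trunc)
    show "case_sum (v \<circ> Inl) (trunc m y \<circ> Inl) =
        mat_vec g (case_sum (u \<circ> Inl) (trunc m x \<circ> Inl))"
      unfolding tl by (rule mat_vec_trunc[OF gs p])
    show "mat_vec (mat_transpose g) (case_sum (v \<circ> Inr) (trunc m y \<circ> Inr)) =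
        case_sum (u \<circ> Inr) (trunc m x \<circ> Inr)"
      unfolding tr by (rule mat_vec_trunc[OF supported_transpose[OF gs] q[symmetric], symmetric])
  qed
  have 2: "(\<forall>i. slice i x \<in> R)" if "x \<in> tensor_Zp m R" "zp_submodule (std_space k) R" for x R
    using that zp_submodule_0[OF that(2)] by (auto simp: tensor_Zp_def) (metis not_less)
  let ?E = "\<lambda>u v x y. case_sum (v \<circ> Inl) (y \<circ> Inl) = mat_vec g (case_sum (u \<circ> Inl) (x \<circ> Inl)) \<and>
      mat_vec (mat_transpose g) (case_sum (v \<circ> Inr) (y \<circ> Inr)) = case_sum (u \<circ> Inr) (x \<circ> Inr)"
  have 3: "(\<exists>x\<in>tensor_Zp m Q. \<exists>y\<in>tensor_Zp m T. ?E u v x y) =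
      (\<exists>x y. (\<forall>i. slice i x \<in> Q) \<and> (\<forall>i. slice i y \<in> T) \<and> ?E u v x y)"
    for u v :: "nat + nat \<Rightarrow> 'p padic"
  proof
    assume "\<exists>x\<in>tensor_Zp m Q. \<exists>y\<in>tensor_Zp m T. ?E u v x y"
    then show "\<exists>x y. (\<forall>i. slice i x \<in> Q) \<and> (\<forall>i. slice i y \<in> T) \<and> ?E u v x y"
      using 2[OF _ Q] 2[OF _ T] by blast
  next
    assume "\<exists>x y. (\<forall>i. slice i x \<in> Q) \<and> (\<forall>i. slice i y \<in> T) \<and> ?E u v x y"
    then show "\<exists>x\<in>tensor_Zp m Q. \<exists>y\<in>tensor_Zp m T. ?E u v x y"
      by (elim exE conjE) (rule 1)
  qed
  show ?thesis unfolding chi_rep_def chi_all_def iff 3 ..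
qed

lemma kron_Inr:
  "kron (Inr (j, n)) (Inr (j', n')) = (if j = j' then kron n n' else 0)"
  by (simp add: kron_def)

lemma supported_block_diag:
  assumes "finite (nontriv_entries u)"
  shows "\<exists>m. \<forall>M\<ge>m. supported {..<M} u \<and> supported (idx_upto \<alpha> k M) (block_diag k u)"
proof -
  have "finite (fst ` nontriv_entries u \<union> snd ` nontriv_entries u)" using assms by simp
  then obtain m where m: "fst ` nontriv_entries u \<union> snd ` nontriv_entries u \<subseteq> {..<m}"
    by (meson finite_nat_iff_bounded)
  have u: "supported {..<M} u" if "m \<le> M" for M using m that by force
  have "supported (idx_upto \<alpha> k M) (block_diag k u)" if "m \<le> M" for M
  proof
    fix z assume "z \<in> nontriv_entries (block_diag k u)"
    then obtain a b where ab: "z = (a, b)" "block_diag k u a b \<noteq> kron a b"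
      by (auto simp: nontriv_entries_def)
    obtain j n n' where z: "z = (Inr (j, n), Inr (j, n'))" "j < k" "u n n' \<noteq> kron n n'"
      using ab by (cases a; cases b) (auto simp: block_diag_def kron_Inr split: if_splits)
    then have "(n, n') \<in> nontriv_entries u" by (simp add: nontriv_entries_def)
    with u[OF that] have "n < M" "n' < M" by auto
    with z show "z \<in> idx_upto \<alpha> k M \<times> idx_upto \<alpha> k M" by (auto simp: idx_upto_def)
  qed
  with u show ?thesis by blast
qed

lemma sum_idx_upto:
  "(\<Sum>c\<in>idx_upto \<alpha> k m. f c) = (\<Sum>i<\<alpha>. f (Inl i)) + (\<Sum>j<k. \<Sum>i<m. f (Inr (j, i)))"
proof -
  have "(\<Sum>c\<in>idx_upto \<alpha> k m. f c) = sum f (Inl ` {..<\<alpha>}) + sum f (Inr ` ({..<k} \<times> {..<m}))"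
    unfolding idx_upto_def by (rule sum.union_disjoint) auto
  then show ?thesis by (simp add: sum.reindex sum.cartesian_product split_def)
qed

lemma mat_vec_block_diag:
  assumes "finite (nontriv_entries u)"
  shows "mat_vec (block_diag k u) (case_sum w z) =
    case_sum w (\<lambda>(j, n). if j < k then mat_vec u (\<lambda>i. z (j, i)) n else z (j, n))"
proof
  fix a
  obtain m where *: "\<forall>M\<ge>m. supported {..<M} u \<and> supported (idx_upto 0 k M) (block_diag k u)"
    using supported_block_diag[OF assms] by blast
  then have u: "supported {..<m} u" and s: "supported (idx_upto 0 k m) (block_diag k u)" by auto
  note mv = mat_vec_eq[OF finite_idx_upto s]
  show "mat_vec (block_diag k u) (case_sum w z) a =
    case_sum w (\<lambda>(j, n). if j < k then mat_vec u (\<lambda>i. z (j, i)) n else z (j, n)) a"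
  proof (cases "a \<in> idx_upto 0 k m")
    case True
    then obtain j n where a: "a = Inr (j, n)" "j < k" "n < m" by (auto simp: idx_upto_def)
    have "mat_vec (block_diag k u) (case_sum w z) a =
        (\<Sum>j'<k. \<Sum>i<m. block_diag k u a (Inr (j', i)) * z (j', i))"
      using True by (simp add: mv sum_idx_upto)
    also have "\<dots> = (\<Sum>j'<k. if j' = j then (\<Sum>i<m. u n i * z (j, i)) else 0)"
      by (rule sum.cong) (auto simp: a block_diag_def kron_def)
    also have "\<dots> = (\<Sum>i<m. u n i * z (j, i))" using a by simp
    finally show ?thesis using a by (simp add: mat_vec_eq[OF _ u])
  next
    case False
    then show ?thesis
      by (auto simp: mv idx_upto_def mat_vec_eq[OF _ u] split: sum.splits)
  qed
qed

lemma block_diag_transpose: "mat_transpose (block_diag k u) = block_diag k (mat_transpose u)"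
  by (intro ext) (auto simp: mat_transpose_def block_diag_def kron_def split: sum.splits)

lemma O_inf_transpose: "u \<in> O_inf \<Longrightarrow> mat_transpose u \<in> O_inf"
proof -
  assume u: "u \<in> O_inf"
  have "nontriv_entries (mat_transpose u) = prod.swap ` nontriv_entries u"
    by (force simp: nontriv_entries_def mat_transpose_def kron_def image_iff)
  then show ?thesis using u by (auto simp: O_inf_def) (simp add: mat_transpose_def)
qed

lemma block_diag_mult_transpose:
  assumes u: "u \<in> O_inf"
  shows "mat_mult (block_diag k u) (block_diag k (mat_transpose u)) = kron"
proof (intro ext)
  fix a b :: idx
  have fin: "finite (nontriv_entries u)" "finite (nontriv_entries (mat_transpose u))"
    using u O_inf_transpose[OF u] by (auto simp: O_inf_def)
  obtain m where J: "supported {..<m} u" using supported_block_diag[OF fin(1)] by blast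
  have inv: "mat_vec u (mat_vec (mat_transpose u) w) = w" for w
    using mat_vec_mult[OF _ J supported_transpose[OF J], of w] u by (simp add: O_inf_def mat_vec_col)
  have cs: "w = case_sum (w \<circ> Inl) (w \<circ> Inr)" for w :: "idx \<Rightarrow> 'a padic"
    by (auto simp: fun_eq_iff split: sum.splits)
  have id: "mat_vec (block_diag k u) (mat_vec (block_diag k (mat_transpose u)) w) = w"
    for w :: "idx \<Rightarrow> 'a padic"
    by (subst (1 2) cs[of w])
      (auto simp: mat_vec_block_diag[OF fin(1)] mat_vec_block_diag[OF fin(2)] fun_eq_iff inv
        split: sum.splits)
  have "block_diag k (mat_transpose u) c b = mat_vec (block_diag k (mat_transpose u)) (\<lambda>c. kron c b) c"
    for c using mat_mult_kron_right[of "block_diag k (mat_transpose u)"]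
    by (simp add: mat_mult_col[abs_def] fun_eq_iff)
  then show "mat_mult (block_diag k u) (block_diag k (mat_transpose u)) a b = kron a b"
    by (simp add: mat_mult_col id)
qed

lemma K_sub_transpose: "h \<in> K_sub k \<Longrightarrow> mat_transpose h \<in> K_sub k"
  unfolding K_sub_def using O_inf_transpose block_diag_transpose by blast

lemma K_sub_mult_transpose: "h \<in> K_sub k \<Longrightarrow> mat_mult h (mat_transpose h) = kron"
  by (auto simp: K_sub_def block_diag_transpose block_diag_mult_transpose)

lemma K_sub_transpose_mult: "h \<in> K_sub k \<Longrightarrow> mat_mult (mat_transpose h) h = kron"
  using K_sub_mult_transpose[OF K_sub_transpose[of h k]] by simp

lemma K_sub_finitary: "h \<in> K_sub k \<Longrightarrow> h \<in> carrier (finitary_monoid \<alpha> k)"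
  using supported_block_diag[where k = k and \<alpha> = \<alpha>]
  unfolding finitary_carrier_iff K_sub_def O_inf_def by blast

lemma K_sub_GL: "h \<in> K_sub k \<Longrightarrow> h \<in> carrier (GL_inf \<alpha> k)"
  unfolding GL_inf_carrier_iff
  using K_sub_finitary K_sub_transpose K_sub_mult_transpose K_sub_transpose_mult by blast

lemma K_sub_act:
  assumes h: "h \<in> K_sub k" and Q: "zp_submodule (std_space k) Q"
    and x: "\<forall>i. slice i (x :: nat \<times> nat + nat \<times> nat \<Rightarrow> 'p::prime_card padic) \<in> Q"
  obtains x' where "\<forall>i. slice i x' \<in> Q"
    "\<And>w. mat_vec h (case_sum w (x \<circ> Inl)) = case_sum w (x' \<circ> Inl)"
    "\<And>w. mat_vec h (case_sum w (x \<circ> Inr)) = case_sum w (x' \<circ> Inr)"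
proof -
  obtain u where u: "u \<in> O_inf" "h = block_diag k u" using h by (auto simp: K_sub_def)
  then have fin: "finite (nontriv_entries u)" and Zp: "\<And>i j. u i j \<in> \<int>\<^sub>p" by (auto simp: O_inf_def)
  obtain m where J: "supported {..<m} u" using supported_block_diag[OF fin] by blast
  define x' :: "nat \<times> nat + nat \<times> nat \<Rightarrow> 'p padic" where
    "x' = case_sum (\<lambda>(j, n). mat_vec u (\<lambda>i. x (Inl (j, i))) n)
                   (\<lambda>(j, n). mat_vec u (\<lambda>i. x (Inr (j, i))) n)"
  have "slice n x' s = (if n < m then \<Sum>i<m. u n i * slice i x s else slice n x s)" for n s
    by (cases s) (auto simp: x'_def slice_def mat_vec_eq[OF _ J])
  moreover have "(\<Sum>i\<in>A. (\<lambda>s. u n i * slice i x s)) s = (\<Sum>i\<in>A. u n i * slice i x s)"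
    if "finite A" for A n s using that by (induction A) auto
  ultimately have "slice n x' = (if n < m then \<Sum>i<m. (\<lambda>s. u n i * slice i x s) else slice n x)"
    for n by (auto simp: fun_eq_iff)
  then have 1: "\<forall>i. slice i x' \<in> Q"
    using x Zp by (auto intro!: zp_submodule_sum[OF Q] zp_submodule_scale[OF Q])
  have "slice i x \<in> std_space k" for i using x Q by (auto simp: zp_submodule_def)
  then have 0: "x (Inl (j, i)) = 0 \<and> x (Inr (j, i)) = 0" if "k \<le> j" for i j
    using that by (fastforce simp: std_space_def slice_def)
  have 2: "mat_vec h (case_sum w (x \<circ> Inl)) = case_sum w (x' \<circ> Inl)" for w
    unfolding u(2) mat_vec_block_diag[OF fin]
    by (auto simp: fun_eq_iff x'_def 0 mat_vec_eq[OF _ J] split: sum.splits)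
  have 3: "mat_vec h (case_sum w (x \<circ> Inr)) = case_sum w (x' \<circ> Inr)" for w
    unfolding u(2) mat_vec_block_diag[OF fin]
    by (auto simp: fun_eq_iff x'_def 0 mat_vec_eq[OF _ J] split: sum.splits)
  show thesis by (rule that[OF 1 2 3])
qed

lemma chi_all_subset:
  assumes g: "g \<in> carrier (GL_inf \<alpha> k)" and h: "h \<in> K_sub k" and h': "h' \<in> K_sub k"
    and Q: "zp_submodule (std_space k) Q" and T: "zp_submodule (std_space k) T"
  shows "chi_all \<alpha> g Q T \<subseteq> chi_all \<alpha> (mat_mult (mat_mult h g) h') Q T"
proof
  interpret Group.group "GL_inf \<alpha> k" by (rule group_GL_inf)
  fix z assume "z \<in> chi_all \<alpha> g Q T"
  then obtain u v x y where z: "z = case_sum u v" and uv: "u \<in> std_space \<alpha>" "v \<in> std_space \<alpha>"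
    and x: "\<forall>i. slice i x \<in> Q" and y: "\<forall>i. slice i y \<in> T"
    and p: "case_sum (v \<circ> Inl) (y \<circ> Inl) = mat_vec g (case_sum (u \<circ> Inl) (x \<circ> Inl))"
    and q: "mat_vec (mat_transpose g) (case_sum (v \<circ> Inr) (y \<circ> Inr)) = case_sum (u \<circ> Inr) (x \<circ> Inr)"
    unfolding chi_all_def by blast
  obtain x' where x': "\<forall>i. slice i x' \<in> Q"
    "\<And>w. mat_vec (mat_transpose h') (case_sum w (x \<circ> Inl)) = case_sum w (x' \<circ> Inl)"
    "\<And>w. mat_vec (mat_transpose h') (case_sum w (x \<circ> Inr)) = case_sum w (x' \<circ> Inr)"
    using K_sub_act[OF K_sub_transpose[OF h'] Q x] by metis
  obtain y' where y': "\<forall>i. slice i y' \<in> T"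
    "\<And>w. mat_vec h (case_sum w (y \<circ> Inl)) = case_sum w (y' \<circ> Inl)"
    "\<And>w. mat_vec h (case_sum w (y \<circ> Inr)) = case_sum w (y' \<circ> Inr)"
    using K_sub_act[OF h T y] by metis
  note G = K_sub_GL[OF h, of \<alpha>] K_sub_GL[OF h', of \<alpha>]
  note G' = GL_inf_transpose[OF G(1)] GL_inf_transpose[OF G(2)] GL_inf_transpose[OF g]
  have hg: "mat_mult h g \<in> carrier (GL_inf \<alpha> k)" using m_closed[OF G(1) g] by simp
  have c1: "mat_vec h' (mat_vec (mat_transpose h') w) = w" for w
    using mat_vec_mult_GL[OF G(2) G'(2), of w] K_sub_mult_transpose[OF h'] by (simp add: mat_vec_col)
  have c2: "mat_vec (mat_transpose h) (mat_vec h w) = w" for w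
    using mat_vec_mult_GL[OF G'(1) G(1), of w] K_sub_transpose_mult[OF h] by (simp add: mat_vec_col)
  have "mat_vec (mat_mult (mat_mult h g) h') (case_sum (u \<circ> Inl) (x' \<circ> Inl)) =
      case_sum (v \<circ> Inl) (y' \<circ> Inl)"
    by (simp add: mat_vec_mult_GL[OF hg G(2)] mat_vec_mult_GL[OF G(1) g] c1 y'(2)
        flip: x'(2) p)
  moreover have "mat_vec (mat_transpose (mat_mult (mat_mult h g) h')) (case_sum (v \<circ> Inr) (y' \<circ> Inr)) =
      case_sum (u \<circ> Inr) (x' \<circ> Inr)"
    unfolding mat_transpose_mult[of "mat_mult h g"] mat_vec_mult_GL[OF G'(2) GL_inf_transpose[OF hg]]
    unfolding mat_transpose_mult mat_vec_mult_GL[OF G'(3,1)]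
    by (simp add: c2 q x'(3) flip: y'(3))
  ultimately show "z \<in> chi_all \<alpha> (mat_mult (mat_mult h g) h') Q T"
    unfolding chi_all_def z using uv x'(1) y'(1) by (smt (verit) mem_Collect_eq)
qed

lemma chi_all_invariant:
  assumes g: "g \<in> carrier (GL_inf \<alpha> k)" and h: "h \<in> K_sub k" and h': "h' \<in> K_sub k"
    and Q: "zp_submodule (std_space k) Q" and T: "zp_submodule (std_space k) T"
  shows "chi_all \<alpha> (mat_mult (mat_mult h g) h') Q T = chi_all \<alpha> g Q T"
proof
  interpret Group.group "GL_inf \<alpha> k" by (rule group_GL_inf)
  note G = K_sub_GL[OF h, of \<alpha>] K_sub_GL[OF h', of \<alpha>]
  note G' = GL_inf_transpose[OF G(1)] GL_inf_transpose[OF G(2)]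
  have c: "mat_mult (mat_mult h g) h' \<in> carrier (GL_inf \<alpha> k)"
    using m_closed[OF m_closed[OF G(1) g] G(2)] by simp
  have ginv: "mat_transpose h = inv\<^bsub>GL_inf \<alpha> k\<^esub> h" "mat_transpose h' = inv\<^bsub>GL_inf \<alpha> k\<^esub> h'"
    using K_sub_transpose_mult[OF h] K_sub_transpose_mult[OF h'] G G'
    by (metis GL_inf_simps inv_equality)+
  have "inv\<^bsub>GL_inf \<alpha> k\<^esub> h \<otimes>\<^bsub>GL_inf \<alpha> k\<^esub> (h \<otimes>\<^bsub>GL_inf \<alpha> k\<^esub> g \<otimes>\<^bsub>GL_inf \<alpha> k\<^esub> h') \<otimes>\<^bsub>GL_inf \<alpha> k\<^esub> inv\<^bsub>GL_inf \<alpha> k\<^esub> h' = g"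
    using g G by (simp only: m_assoc m_closed inv_closed r_inv r_one inv_solve_left' flip: m_assoc)
      (simp only: m_assoc l_inv l_one r_inv r_one inv_closed)
  then have "mat_mult (mat_mult (mat_transpose h) (mat_mult (mat_mult h g) h')) (mat_transpose h') = g"
    by (simp add: ginv)
  then show "chi_all \<alpha> (mat_mult (mat_mult h g) h') Q T \<subseteq> chi_all \<alpha> g Q T"
    using chi_all_subset[OF c K_sub_transpose[OF h] K_sub_transpose[OF h'] Q T] by simp
qed (rule chi_all_subset[OF assms])

lemma GL_fin_ex: "g \<in> carrier (GL_inf \<alpha> k) \<Longrightarrow> \<exists>m. g \<in> GL_fin \<alpha> k m"
  using GL_inf_finitary[of g \<alpha> k] unfolding finitary_carrier_iff GL_fin_def by blast

lemma chi_eq_chi_rep: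
  assumes gg: "\<gg> \<in> double_cosets \<alpha> k" and g: "g \<in> \<gg>" "g \<in> GL_fin \<alpha> k m"
    and Q: "zp_submodule (std_space k) Q" and T: "zp_submodule (std_space k) T"
  shows "chi \<alpha> k \<gg> Q T = chi_rep \<alpha> k m g Q T"
proof -
  obtain g0 where g0: "g0 \<in> carrier (GL_inf \<alpha> k)"
    and \<gg>: "\<gg> = (K_sub k #>\<^bsub>GL_inf \<alpha> k\<^esub> g0) <#>\<^bsub>GL_inf \<alpha> k\<^esub> K_sub k"
    using gg by (auto simp: double_cosets_def)
  have *: "chi_rep \<alpha> k n f Q T = chi_all \<alpha> g0 Q T" if f: "f \<in> \<gg>" "f \<in> GL_fin \<alpha> k n" for f n
  proof -
    obtain h h' where "h \<in> K_sub k" "h' \<in> K_sub k" "f = mat_mult (mat_mult h g0) h'"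
      using f(1) by (auto simp: \<gg> r_coset_def set_mult_def)
    then show ?thesis
      using chi_all_invariant[OF g0 _ _ Q T] chi_rep_eq_chi_all[OF f(2) Q T] by simp
  qed
  define mg where "mg = (SOME (m, g). g \<in> \<gg> \<and> g \<in> GL_fin \<alpha> k m)"
  have "case mg of (m, g) \<Rightarrow> g \<in> \<gg> \<and> g \<in> GL_fin \<alpha> k m"
    unfolding mg_def by (rule someI[of _ "(m, g)"]) (use g in simp)
  then show ?thesis
    unfolding chi_def mg_def[symmetric] using * g by (cases mg) auto
qed

end

theory Submission
  imports Defs
begin

text \<open>
  Write \<open>G = diag(g, g\<^sup>-\<^sup>t)\<close>, a symplectic operator on \<open>\<V> \<oplus> \<H> \<otimes> \<rat>\<^sub>p\<^sup>m\<close>. Then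
  \<open>\<chi>(Q, T)\<close> consists of the pairs \<open>(u, v)\<close> with \<open>(v, y) = G (u, x)\<close> for some
  \<open>x \<in> Q \<otimes> \<int>\<^sub>p\<^sup>m\<close>, \<open>y \<in> T \<otimes> \<int>\<^sub>p\<^sup>m\<close>; it is clearly monotone in \<open>(Q, T)\<close>, and invariance of the form
  under \<open>G\<close> turns the values of \<open>B\<^sup>\<ominus>\<close> on it into sums of values of the forms on \<open>Q\<close> and \<open>T\<close>.
  It remains to see that \<open>\<chi>(Q, T)\<close> is self-dual when \<open>Q\<close> and \<open>T\<close> are. This follows by duality
  from the fact that every \<open>\<int>\<^sub>p\<close>-submodule of \<open>\<rat>\<^sub>p\<^sup>n\<close>, lattice or not, is the intersection of the sets
  on which a linear functional is integral. That fact is proved by induction on \<open>n\<close> and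
  rests on the completeness of \<open>\<int>\<^sub>p\<close>.
\<close>

section \<open>Arithmetic of the \<open>p\<close>-adic integers\<close>

lemma Rep_padic_int_compat:
  "\<forall>n. Rep_padic_int (x :: 'p::prime_card padic_int) n = Rep_padic_int x (Suc n) mod int CARD('p) ^ n"
  using Rep_padic_int[of x] by (rule CollectD)

lemma Rep_padic_int_mod:
  "Rep_padic_int (x :: 'p::prime_card padic_int) n mod int CARD('p) ^ n = Rep_padic_int x n"
  by (rule padic_trivial_mod[OF Rep_padic_int_compat])

lemma Rep_padic_int_Suc:
  "Rep_padic_int (x :: 'p::prime_card padic_int) (Suc n) mod int CARD('p) ^ n = Rep_padic_int x n"
  using spec[OF Rep_padic_int_compat] by (rule sym)

lemma Rep_padic_int_add:
  "Rep_padic_int (x :: 'p::prime_card padic_int) (n + d) mod int CARD('p) ^ n = Rep_padic_int x n"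
proof (induction d)
  case (Suc d)
  have "Rep_padic_int x (Suc (n + d)) mod int CARD('p) ^ (n + d) mod int CARD('p) ^ n =
      Rep_padic_int x (Suc (n + d)) mod int CARD('p) ^ n"
    by (rule mod_mod_cancel) (simp add: le_imp_power_dvd)
  with Suc show ?case by (simp add: Rep_padic_int_Suc)
qed (simp add: Rep_padic_int_mod)

lemma Rep_padic_int_of_nat:
  "Rep_padic_int (of_nat m :: 'p::prime_card padic_int) n = int m mod int CARD('p) ^ n"
  by (induction m) (simp_all add: zero_padic_int.rep_eq plus_padic_int.rep_eq one_padic_int.rep_eq mod_simps)

lemma Rep_Abs_padic_int:
  assumes "\<And>n. f n = f (Suc n) mod int CARD('p::prime_card) ^ n"
  shows "Rep_padic_int (Abs_padic_int f :: 'p padic_int) = f"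
  by (intro Abs_padic_int_inverse CollectI allI) (rule assms)

lemma padic_int_eqI: "(\<And>n. Rep_padic_int x n = Rep_padic_int y n) \<Longrightarrow> x = y"
  by (simp add: Rep_padic_int_inject[symmetric] fun_eq_iff)

lemma CARD_gt_1: "int CARD('p::prime_card) > 1"
  using prime_card_int[where 'a = 'p] by (rule prime_gt_1_int)

text \<open>This turns divisibility, an algebraic notion, into the vanishing of one residue. The
  converse builds the quotient residue by residue.\<close>

lemma padic_int_dvd_iff:
  fixes x :: "'p::prime_card padic_int"
  shows "of_nat CARD('p) ^ n dvd x \<longleftrightarrow> Rep_padic_int x n = 0"
proof
  assume "of_nat CARD('p) ^ n dvd x"
  then obtain y where "x = of_nat (CARD('p) ^ n) * y" by (auto simp: of_nat_power)
  then show "Rep_padic_int x n = 0"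
    by (simp add: times_padic_int.rep_eq Rep_padic_int_of_nat del: of_nat_power) (simp add: mod_simps)
next
  let ?p = "int CARD('p)"
  assume 0: "Rep_padic_int x n = 0"
  \<comment> \<open>Dividing by p^n costs n digits of precision, so the k-th residue of the quotient
    is read off from residue n + k of \<open>x\<close>.\<close>
  define f where "f k = Rep_padic_int x (n + k) div ?p ^ n" for k
  have dvd: "?p ^ n * f k = Rep_padic_int x (n + k)" for k
  proof -
    have "?p ^ n dvd Rep_padic_int x (n + k)"
      using Rep_padic_int_add[of x n k] 0 by (simp add: dvd_eq_mod_eq_0)
    then show ?thesis by (simp add: f_def)
  qed
  have f: "f k = f (Suc k) mod ?p ^ k" for k
  proof -
    have "?p ^ n * (f (Suc k) mod ?p ^ k) = Rep_padic_int x (Suc (n + k)) mod ?p ^ (n + k)"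
      using dvd[of "Suc k"] by (simp only: mult_mod_right power_add add_Suc_right)
    also have "\<dots> = ?p ^ n * f k" by (simp only: Rep_padic_int_Suc dvd)
    finally show ?thesis by simp
  qed
  define y :: "'p padic_int" where "y = Abs_padic_int f"
  have y: "Rep_padic_int y = f"
    unfolding y_def by (rule Rep_Abs_padic_int) (rule f)
  have "x = of_nat (CARD('p) ^ n) * y"
  proof (rule padic_int_eqI)
    fix k
    have "Rep_padic_int (of_nat (CARD('p) ^ n) * y) k = (?p ^ n * f k) mod ?p ^ k"
      by (simp add: times_padic_int.rep_eq Rep_padic_int_of_nat y mod_simps del: of_nat_power) simp
    also have "\<dots> = Rep_padic_int x k"
      using Rep_padic_int_add[of x k n] by (simp add: dvd add.commute)
    finally show "Rep_padic_int x k = Rep_padic_int (of_nat (CARD('p) ^ n) * y) k" ..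
  qed
  then show "of_nat CARD('p) ^ n dvd x" by (simp add: dvd_def)
qed

text \<open>Every residue of \<open>x\<close> is prime to p and so invertible modulo p^n. Inverses
  modulo p^n are unique, hence compatible, and form an element of the inverse limit.\<close>

lemma padic_int_unit:
  fixes x :: "'p::prime_card padic_int"
  assumes "\<not> of_nat CARD('p) dvd x"
  shows "x dvd 1"
proof -
  let ?p = "int CARD('p)"
  have x1: "Rep_padic_int x 1 \<noteq> 0" using padic_int_dvd_iff[of 1 x] assms by simp
  have cop: "coprime (Rep_padic_int x n) (?p ^ n)" for n
  proof (cases n)
    case (Suc m)
    have "\<not> ?p dvd Rep_padic_int x n"
      using x1 Rep_padic_int_add[of x 1 m] by (simp add: Suc dvd_eq_mod_eq_0)
    then show ?thesis
      using prime_imp_coprime[OF prime_card_int[where 'a = 'p]] by (auto simp: coprime_commute)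
  qed simp
  have "\<exists>y. \<forall>n. (Rep_padic_int x n * y n) mod ?p ^ n = 1 mod ?p ^ n"
    using cong_solve_coprime_int[OF cop] unfolding cong_def by (intro choice allI)
  then obtain y where y: "\<And>n. (Rep_padic_int x n * y n) mod ?p ^ n = 1 mod ?p ^ n" by blast
  define f where "f n = y n mod ?p ^ n" for n
  have f: "f n = f (Suc n) mod ?p ^ n" for n
  proof -
    have "(Rep_padic_int x n * y (Suc n)) mod ?p ^ n = (Rep_padic_int x (Suc n) * y (Suc n)) mod ?p ^ n"
      by (metis Rep_padic_int_Suc mod_mult_left_eq)
    also have "\<dots> = 1 mod ?p ^ n" by (metis y mod_Suc_power)
    finally have "[Rep_padic_int x n * y (Suc n) = Rep_padic_int x n * y n] (mod ?p ^ n)"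
      by (simp add: y cong_def)
    \<comment> \<open>Uniqueness of the inverse: the residue of \<open>x\<close> is cancelled, being
      coprime to p^n.\<close>
    then have "[y (Suc n) = y n] (mod ?p ^ n)"
      using cong_mult_lcancel[OF cop] by blast
    then show ?thesis by (simp only: f_def mod_Suc_power) (simp add: cong_def)
  qed
  define z :: "'p padic_int" where "z = Abs_padic_int f"
  have "Rep_padic_int z = f"
    unfolding z_def by (rule Rep_Abs_padic_int) (rule f)
  then have "x * z = 1"
    by (intro padic_int_eqI)
      (simp add: times_padic_int.rep_eq one_padic_int.rep_eq f_def y mod_simps)
  then show ?thesis by (metis dvd_triv_left)
qed

lemma padic_int_factor:
  fixes x :: "'p::prime_card padic_int"
  assumes "x \<noteq> 0"
  obtains n u where "x = of_nat CARD('p) ^ n * u" "u dvd 1"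
proof -
  let ?p = "of_nat CARD('p) :: 'p padic_int"
  have "\<exists>n. Rep_padic_int x n \<noteq> 0"
    using assms padic_int_eqI[of x 0] by (auto simp: zero_padic_int.rep_eq)
  then obtain N where "Rep_padic_int x N \<noteq> 0" "\<And>n. n < N \<Longrightarrow> Rep_padic_int x n = 0"
    by (meson exists_least_iff)
  then have N: "\<not> ?p ^ N dvd x" "\<And>n. n < N \<Longrightarrow> ?p ^ n dvd x" by (simp_all only: padic_int_dvd_iff not_False_eq_True)
  \<comment> \<open>\<open>N\<close> is the least exponent at which divisibility fails; it is
    positive because p^0 divides everything, so the valuation is \<open>N\<close> - 1.\<close>
  then obtain n where n: "N = Suc n" by (cases N) auto
  then obtain u where u: "x = ?p ^ n * u" using N(2)[of n] by (auto elim: dvdE)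
  have "\<not> ?p dvd u" using N(1) by (auto simp: n u mult_ac elim!: dvdE)
  then show thesis using that u padic_int_unit by blast
qed

text \<open>Diagonal argument: the n-th residue of the limit is the n-th residue of the n-th term,
  which no later term changes.\<close>

lemma padic_int_complete:
  fixes b :: "nat \<Rightarrow> 'p::prime_card padic_int"
  assumes "\<And>n. of_nat CARD('p) ^ n dvd b (Suc n) - b n"
  shows "\<exists>c. \<forall>n. of_nat CARD('p) ^ n dvd c - b n"
proof -
  let ?p = "int CARD('p)"
  define f where "f n = Rep_padic_int (b n) n" for n
  have "f n = f (Suc n) mod ?p ^ n" for n
  proof -
    have "(Rep_padic_int (b (Suc n)) n - Rep_padic_int (b n) n) mod ?p ^ n = 0"
      using assms[of n] unfolding padic_int_dvd_iff by (simp add: minus_padic_int.rep_eq)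
    then have "Rep_padic_int (b (Suc n)) n = Rep_padic_int (b n) n"
      by (simp add: Rep_padic_int_mod flip: dvd_eq_mod_eq_0 mod_eq_dvd_iff)
    then show ?thesis by (simp add: f_def Rep_padic_int_Suc)
  qed
  then have "Rep_padic_int (Abs_padic_int f :: 'p padic_int) = f"
    by (rule Rep_Abs_padic_int)
  then have "of_nat CARD('p) ^ n dvd (Abs_padic_int f :: 'p padic_int) - b n" for n
    unfolding padic_int_dvd_iff by (simp add: minus_padic_int.rep_eq f_def)
  then show ?thesis by blast
qed

section \<open>The field \<open>\<rat>\<^sub>p\<close>\<close>

lemma of_padic_int_0 [simp]: "of_padic_int 0 = 0"
  by (simp add: of_padic_int_def Zero_fract_def)

lemma of_padic_int_uminus: "of_padic_int (- a) = - of_padic_int a"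
  by (simp add: of_padic_int_def)

lemma of_padic_int_diff: "of_padic_int (a - b) = of_padic_int a - of_padic_int b"
  by (simp add: of_padic_int_def)

lemma of_padic_int_of_nat: "of_padic_int (of_nat n) = of_nat n"
  by (induction n) (simp_all add: of_padic_int_hom)

lemma of_padic_int_power: "of_padic_int (a ^ n) = of_padic_int a ^ n"
  by (induction n) (simp_all add: of_padic_int_hom)

lemma of_padic_int_eq_iff: "of_padic_int a = of_padic_int b \<longleftrightarrow> a = b"
  by (simp add: of_padic_int_def eq_fract)

lemma padic_ints_of_padic_int [simp]: "of_padic_int a \<in> \<int>\<^sub>p"
  by (simp add: padic_ints_def)

lemma padic_ints_0 [simp]: "0 \<in> \<int>\<^sub>p"
  using padic_ints_of_padic_int[of 0] by simp

lemma padic_ints_of_nat [simp]: "of_nat n \<in> \<int>\<^sub>p"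
  using padic_ints_of_padic_int[of "of_nat n"] by (simp add: of_padic_int_of_nat)

lemma padic_ints_1 [simp]: "1 \<in> \<int>\<^sub>p"
  using padic_ints_of_nat[of 1] by simp

lemma padic_ints_add: "a \<in> \<int>\<^sub>p \<Longrightarrow> b \<in> \<int>\<^sub>p \<Longrightarrow> a + b \<in> \<int>\<^sub>p"
  by (auto simp: padic_ints_def simp flip: of_padic_int_hom)

lemma padic_ints_mult: "a \<in> \<int>\<^sub>p \<Longrightarrow> b \<in> \<int>\<^sub>p \<Longrightarrow> a * b \<in> \<int>\<^sub>p"
  by (auto simp: padic_ints_def simp flip: of_padic_int_hom)

lemma padic_ints_uminus: "a \<in> \<int>\<^sub>p \<Longrightarrow> - a \<in> \<int>\<^sub>p"
  by (auto simp: padic_ints_def simp flip: of_padic_int_uminus)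

lemma padic_ints_diff: "a \<in> \<int>\<^sub>p \<Longrightarrow> b \<in> \<int>\<^sub>p \<Longrightarrow> a - b \<in> \<int>\<^sub>p"
  by (auto simp: padic_ints_def simp flip: of_padic_int_diff)

lemma padic_ints_power: "a \<in> \<int>\<^sub>p \<Longrightarrow> a ^ n \<in> \<int>\<^sub>p"
  by (induction n) (simp_all add: padic_ints_mult)

lemma padic_ints_of_nat_power [simp]: "of_nat m ^ n \<in> \<int>\<^sub>p"
  by (simp add: padic_ints_power)

lemma padic_ints_sum: "(\<And>i. i \<in> I \<Longrightarrow> f i \<in> \<int>\<^sub>p) \<Longrightarrow> sum f I \<in> \<int>\<^sub>p"
  by (induction I rule: infinite_finite_induct) (simp_all add: padic_ints_add)

lemma of_nat_CARD_nonzero [simp]: "of_nat CARD('p) \<noteq> (0 :: 'p::prime_card padic)"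
proof
  assume "of_nat CARD('p) = (0 :: 'p padic)"
  then have "of_nat CARD('p) = (0 :: 'p padic_int)"
    by (metis of_padic_int_eq_iff of_padic_int_of_nat of_padic_int_0)
  \<comment> \<open>Residue 2 rather than 1 is taken, since p does vanish modulo p.\<close>
  then have "Rep_padic_int (of_nat CARD('p) :: 'p padic_int) 2 = 0"
    by (simp add: zero_padic_int.rep_eq)
  then have "int CARD('p) mod int CARD('p) ^ 2 = 0" by (simp only: Rep_padic_int_of_nat)
  moreover have "int CARD('p) < int CARD('p) ^ 2"
    using CARD_gt_1[where 'p = 'p] by (simp add: power2_eq_square)
  ultimately show False by simp
qed

text \<open>Unit times a power of p; the disjunction replaces an integer exponent. It comes from
  factoring numerator and denominator of a fraction.\<close>

lemma padic_factor:
  fixes x :: "'p::prime_card padic"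
  assumes "x \<noteq> 0"
  obtains n u where "u \<in> \<int>\<^sub>p" "u \<noteq> 0" "inverse u \<in> \<int>\<^sub>p"
    "x = of_nat CARD('p) ^ n * u \<or> x = u / of_nat CARD('p) ^ n"
proof -
  let ?p = "of_nat CARD('p) :: 'p padic"
  have *: "\<exists>n u. of_padic_int a = ?p ^ n * u \<and> u \<noteq> 0 \<and> u \<in> \<int>\<^sub>p \<and> inverse u \<in> \<int>\<^sub>p"
    if a: "a \<noteq> 0" for a :: "'p padic_int"
  proof -
    obtain n u where u: "a = of_nat CARD('p) ^ n * u" "u dvd 1" by (rule padic_int_factor[OF a])
    then obtain w where "1 = u * w" by (auto elim: dvdE)
    then have w: "of_padic_int u * of_padic_int w = 1" by (metis of_padic_int_hom(2,3))
    then have "inverse (of_padic_int u) = of_padic_int w" by (rule inverse_unique)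
    moreover have "of_padic_int u \<noteq> 0" using w by auto
    moreover have "of_padic_int a = ?p ^ n * of_padic_int u"
      by (simp add: u(1) of_padic_int_hom of_padic_int_power of_padic_int_of_nat)
    ultimately show ?thesis by (metis padic_ints_of_padic_int)
  qed
  obtain a b where ab: "x = Fraction_Field.Fract a b" "b \<noteq> 0" by (cases x) auto
  then have x: "x = of_padic_int a / of_padic_int b"
    by (simp add: of_padic_int_def)
  then have "a \<noteq> 0" using assms by auto
  from *[OF this] obtain i u where u: "of_padic_int a = ?p ^ i * u" "u \<noteq> 0" "u \<in> \<int>\<^sub>p" "inverse u \<in> \<int>\<^sub>p"
    by blast
  from *[OF ab(2)] obtain j w where w: "of_padic_int b = ?p ^ j * w" "w \<noteq> 0" "w \<in> \<int>\<^sub>p" "inverse w \<in> \<int>\<^sub>p"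
    by blast
  have 1: "u * inverse w \<in> \<int>\<^sub>p" "u * inverse w \<noteq> 0" "inverse (u * inverse w) \<in> \<int>\<^sub>p"
    using u w by (auto intro: padic_ints_mult)
  have "x = ?p ^ (i - j) * (u * inverse w) \<or> x = (u * inverse w) / ?p ^ (j - i)"
  proof (cases "j \<le> i")
    case True
    then have "?p ^ i = ?p ^ (i - j) * ?p ^ j" by (simp flip: power_add)
    then show ?thesis using w(2) by (simp add: x u(1) w(1) field_simps)
  next
    case False
    then have "?p ^ j = ?p ^ (j - i) * ?p ^ i" by (simp flip: power_add)
    then show ?thesis using w(2) by (simp add: x u(1) w(1) field_simps)
  qed
  then show thesis using that[OF 1] by blast
qed

lemma padic_scale_int: "\<exists>n. of_nat CARD('p) ^ n * (x :: 'p::prime_card padic) \<in> \<int>\<^sub>p"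
proof (cases "x = 0")
  case False
  then obtain n u where "u \<in> \<int>\<^sub>p" "x = of_nat CARD('p) ^ n * u \<or> x = u / of_nat CARD('p) ^ n"
    using padic_factor by metis
  then have "of_nat CARD('p) ^ n * x \<in> \<int>\<^sub>p"
    by (auto simp: padic_ints_mult)
  then show ?thesis ..
qed simp

text \<open>The valuation of \<open>x\<close> is at most -1, so that of p \<open>x\<close> is at
  most 0.\<close>

lemma inverse_nonint:
  fixes x :: "'p::prime_card padic"
  assumes "x \<notin> \<int>\<^sub>p"
  shows "inverse (of_nat CARD('p) * x) \<in> \<int>\<^sub>p"
proof -
  have "x \<noteq> 0" using assms by auto
  then obtain n u where u: "u \<in> \<int>\<^sub>p" "u \<noteq> 0" "inverse u \<in> \<int>\<^sub>p"
    "x = of_nat CARD('p) ^ n * u \<or> x = u / of_nat CARD('p) ^ n"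
    by (rule padic_factor)
  then have x: "x = u / of_nat CARD('p) ^ n"
    using assms padic_ints_mult[OF padic_ints_of_nat_power u(1)] by metis
  with assms u obtain m where "n = Suc m" by (cases n) auto
  then have "inverse (of_nat CARD('p) * x) = of_nat CARD('p) ^ m * inverse u"
    using u(2) by (simp add: x field_simps)
  then show ?thesis using u by (simp add: padic_ints_mult)
qed

lemma inverse_CARD_nonint: "inverse (of_nat CARD('p)) \<notin> (\<int>\<^sub>p :: 'p::prime_card padic set)"
proof
  assume "inverse (of_nat CARD('p)) \<in> (\<int>\<^sub>p :: 'p padic set)"
  then obtain a :: "'p padic_int" where "inverse (of_nat CARD('p)) = of_padic_int a"
    by (auto simp: padic_ints_def)
  then have "of_nat CARD('p) * of_padic_int a = (1 :: 'p padic)"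
    by (metis of_nat_CARD_nonzero right_inverse)
  then have "of_nat CARD('p) * a = 1"
    by (metis of_padic_int_eq_iff of_padic_int_hom(2,3) of_padic_int_of_nat)
  then have "of_nat CARD('p) ^ 1 dvd (1 :: 'p padic_int)" by (metis dvd_triv_left power_one_right)
  then have "Rep_padic_int (1 :: 'p padic_int) 1 = 0" by (simp only: padic_int_dvd_iff)
  then show False using CARD_gt_1[where 'p = 'p] by (simp add: one_padic_int.rep_eq)
qed

text \<open>The terms themselves need not be integral: after subtracting \<open>b 0\<close> the
  sequence lies in Z_p, where completeness is already known.\<close>

lemma padic_complete:
  fixes b :: "nat \<Rightarrow> 'p::prime_card padic"
  assumes "\<And>n. (b (Suc n) - b n) / of_nat CARD('p) ^ n \<in> \<int>\<^sub>p"
  shows "\<exists>c. \<forall>n. (c - b n) / of_nat CARD('p) ^ n \<in> \<int>\<^sub>p"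
proof -
  let ?p = "of_nat CARD('p) :: 'p padic"
  have step: "b (Suc n) - b n \<in> \<int>\<^sub>p" for n
    using padic_ints_mult[OF padic_ints_power[OF padic_ints_of_nat] assms, of "CARD('p)" n n] by simp
  have "b n - b 0 \<in> \<int>\<^sub>p" for n
  proof (induction n)
    case (Suc n)
    show ?case using padic_ints_add[OF step[of n] Suc] by simp
  qed simp
  then have "\<forall>n. \<exists>a. b n = b 0 + of_padic_int a" by (simp add: padic_ints_def image_iff algebra_simps)
  then obtain a where a: "\<And>n. b n = b 0 + of_padic_int (a n)" by metis
  have "of_nat CARD('p) ^ n dvd a (Suc n) - a n" for n
  proof -
    have "(of_padic_int (a (Suc n)) - of_padic_int (a n)) / ?p ^ n \<in> \<int>\<^sub>p"
      using assms[of n] a[of n] a[of "Suc n"] by (metis add_diff_cancel_left)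
    then obtain z where "(of_padic_int (a (Suc n)) - of_padic_int (a n)) / ?p ^ n = of_padic_int z"
      by (auto simp: padic_ints_def)
    then have "of_padic_int (a (Suc n)) - of_padic_int (a n) = ?p ^ n * of_padic_int z"
      by (simp add: field_simps)
    then have "a (Suc n) - a n = of_nat CARD('p) ^ n * z"
      by (metis of_padic_int_eq_iff of_padic_int_hom(2) of_padic_int_of_nat of_padic_int_diff of_padic_int_power)
    then show ?thesis by simp
  qed
  then obtain c where c: "\<And>n. of_nat CARD('p) ^ n dvd c - a n" using padic_int_complete by blast
  have "(b 0 + of_padic_int c - b n) / ?p ^ n \<in> \<int>\<^sub>p" for n
  proof -
    obtain z where "c - a n = of_nat CARD('p) ^ n * z" using c by (auto elim: dvdE)
    then have "of_padic_int c - of_padic_int (a n) = ?p ^ n * of_padic_int z"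
      by (metis of_padic_int_hom(2) of_padic_int_of_nat of_padic_int_diff of_padic_int_power)
    then show ?thesis using a[of n] by simp
  qed
  then show ?thesis by blast
qed

section \<open>Separation of a point from a submodule\<close>

lemma zp_submodule_add: "zp_submodule V R \<Longrightarrow> f \<in> R \<Longrightarrow> g \<in> R \<Longrightarrow> f + g \<in> R"
  unfolding zp_submodule_def by (auto intro: Modules.module.subspace_add[OF module_zp_scale])

lemma zp_submodule_diff: "zp_submodule V R \<Longrightarrow> f \<in> R \<Longrightarrow> g \<in> R \<Longrightarrow> f - g \<in> R"
  unfolding zp_submodule_def by (auto intro: Modules.module.subspace_diff[OF module_zp_scale])

lemma zp_submoduleI:
  assumes "R \<subseteq> V" "0 \<in> R" "\<And>f g. f \<in> R \<Longrightarrow> g \<in> R \<Longrightarrow> f + g \<in> R"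
    "\<And>c f. f \<in> R \<Longrightarrow> c \<in> \<int>\<^sub>p \<Longrightarrow> (\<lambda>i. c * f i) \<in> R"
  shows "zp_submodule V R"
  using assms unfolding zp_submodule_def Modules.module.subspace_def[OF module_zp_scale]
  by (simp add: zp_scale_def)

text \<open>The i-th coordinate maps \<open>A\<close> onto a Z_p-submodule of Q_p, which is 0,
  generated by one element, or all of Q_p. In the last case the values \<open>q\<close> / p^n,
  together with their Z_p-multiples, exhaust Q_p.\<close>

lemma zp_submodule_coordinate_cases:
  fixes A :: "('i \<Rightarrow> 'p::prime_card padic) set"
  assumes A: "zp_submodule V A"
  obtains (zero) "\<forall>a\<in>A. a i = 0"
  | (lattice) a0 where "a0 \<in> A" "a0 i \<noteq> 0" "\<forall>a\<in>A. a i / a0 i \<in> \<int>\<^sub>p"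
  | (line) q f where "q \<noteq> 0" "\<And>n. f n \<in> A" "\<And>n. f n i = q / of_nat CARD('p) ^ n"
proof -
  let ?p = "of_nat CARD('p) :: 'p padic"
  consider "\<forall>a\<in>A. a i = 0" | a0 where "a0 \<in> A" "a0 i \<noteq> 0" "\<forall>a\<in>A. a i / a0 i \<in> \<int>\<^sub>p"
    | b where "b \<in> A" "b i \<noteq> 0" "\<And>a0. a0 \<in> A \<Longrightarrow> a0 i \<noteq> 0 \<Longrightarrow> \<exists>a\<in>A. a i / a0 i \<notin> \<int>\<^sub>p"
    by blast
  then show thesis
  proof cases
    case 3
    have "\<exists>a\<in>A. a i = b i / ?p ^ n" for n
    proof (induction n)
      case 0
      show ?case using 3(1) by auto
    next
      case (Suc n)
      then obtain a0 where a0: "a0 \<in> A" "a0 i = b i / ?p ^ n" by blast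
      then have nz: "a0 i \<noteq> 0" using 3(2) by simp
      then obtain a where a: "a \<in> A" "a i / a0 i \<notin> \<int>\<^sub>p" using 3(3) a0(1) by blast
      then have "a i \<noteq> 0" by auto
      \<comment> \<open>As \<open>a i / a0 i\<close> is not integral, this multiplier is in Z_p; it
        scales \<open>a\<close> to an element whose coordinate is that of \<open>a0\<close> divided
        by p.\<close>
      then have "inverse (?p * (a i / a0 i)) * a i = b i / ?p ^ Suc n"
        using nz a0(2) by (simp add: field_simps)
      with zp_submodule_scale[OF A a(1) inverse_nonint[OF a(2)]] show ?case
        by (intro bexI) auto
    qed
    then obtain f where "\<And>n. f n \<in> A" "\<And>n. f n i = b i / ?p ^ n" by metis
    with 3(2) show thesis by (rule line)
  qed (use zero lattice in blast)+
qed

text \<open>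
  A \<open>\<rat>\<^sub>p\<close>-linear functional that is integral on the kernel of the \<open>i\<close>-th coordinate becomes integral
  on \<open>A\<close> after adding a multiple of that coordinate. Completeness of \<open>\<int>\<^sub>p\<close> enters when the
  \<open>i\<close>-th coordinate maps \<open>A\<close> onto \<open>\<rat>\<^sub>p\<close>.
\<close>

lemma integral_functional_extend:
  fixes A :: "('i \<Rightarrow> 'p::prime_card padic) set" and \<phi> :: "('i \<Rightarrow> 'p padic) \<Rightarrow> 'p padic"
  assumes A: "zp_submodule V A"
    and diff: "\<And>a b. \<phi> (a - b) = \<phi> a - \<phi> b" and scale: "\<And>c a. \<phi> (\<lambda>i. c * a i) = c * \<phi> a"
    and int: "\<And>a. a \<in> A \<Longrightarrow> a i = 0 \<Longrightarrow> \<phi> a \<in> \<int>\<^sub>p"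
  shows "\<exists>\<gamma>. \<forall>a\<in>A. \<gamma> * a i + \<phi> a \<in> \<int>\<^sub>p"
proof -
  let ?p = "of_nat CARD('p) :: 'p padic"
  \<comment> \<open>The difference of \<open>a\<close> and \<open>s\<close> times \<open>b\<close>
    lies in the kernel of the coordinate, where the functional is integral; so integrality passes
    from \<open>b\<close> to \<open>a\<close>.\<close>
  have reduce: "\<gamma> * a i + \<phi> a \<in> \<int>\<^sub>p"
    if "a \<in> A" "b \<in> A" "s \<in> \<int>\<^sub>p" "a i = s * b i" "\<gamma> * b i + \<phi> b \<in> \<int>\<^sub>p" for a b s \<gamma>
  proof -
    have "\<phi> (a - (\<lambda>i. s * b i)) \<in> \<int>\<^sub>p"
      using that by (intro int zp_submodule_diff[OF A] zp_submodule_scale[OF A]) auto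
    from padic_ints_add[OF this padic_ints_mult[OF that(3,5)]] show ?thesis
      by (simp add: diff scale that(4) algebra_simps)
  qed
  from A show ?thesis
  proof (cases rule: zp_submodule_coordinate_cases[where i = i])
    case zero
    then have "\<forall>a\<in>A. 0 * a i + \<phi> a \<in> \<int>\<^sub>p" by (simp add: int)
    then show ?thesis ..
  next
    case (lattice a0)
    \<comment> \<open>This coefficient makes the extended functional vanish at the generator
      \<open>a0\<close>.\<close>
    have "(- \<phi> a0 / a0 i) * a i + \<phi> a \<in> \<int>\<^sub>p" if "a \<in> A" for a
      using lattice that by (intro reduce[of a a0 "a i / a0 i"]) auto
    then show ?thesis by blast
  next
    case (line q f)
    \<comment> \<open>With \<gamma> = \<delta> / \<open>q\<close>, integrality at \<open>f n\<close>
      says exactly that \<delta> agrees with \<open>b n\<close> modulo p^n. The conditions are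
      compatible because \<open>f n\<close> minus p times \<open>f (Suc n)\<close> has i-th
      coordinate 0, so completeness supplies \<delta>.\<close>
    define b where "b n = - (?p ^ n * \<phi> (f n))" for n
    have "(b (Suc n) - b n) / ?p ^ n \<in> \<int>\<^sub>p" for n
    proof -
      have "\<phi> (f n - (\<lambda>i. ?p * f (Suc n) i)) \<in> \<int>\<^sub>p"
        using line by (intro int zp_submodule_diff[OF A] zp_submodule_scale[OF A]) auto
      also have "\<phi> (f n - (\<lambda>i. ?p * f (Suc n) i)) = (b (Suc n) - b n) / ?p ^ n"
        by (simp add: diff scale b_def field_simps)
      finally show ?thesis .
    qed
    then obtain \<delta> where \<delta>: "\<And>n. (\<delta> - b n) / ?p ^ n \<in> \<int>\<^sub>p" using padic_complete by blast
    have "\<delta> / q * f n i + \<phi> (f n) = (\<delta> - b n) / ?p ^ n" for n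
      using line(1,3) by (simp add: b_def field_simps)
    then have f: "\<delta> / q * f n i + \<phi> (f n) \<in> \<int>\<^sub>p" for n using \<delta> by simp
    have "\<delta> / q * a i + \<phi> a \<in> \<int>\<^sub>p" if a: "a \<in> A" for a
    proof -
      obtain n where "?p ^ n * (a i / q) \<in> \<int>\<^sub>p" using padic_scale_int by blast
      moreover have "a i = ?p ^ n * (a i / q) * f n i" using line by simp
      ultimately show ?thesis using reduce[OF a line(2) _ _ f] by blast
    qed
    then show ?thesis by blast
  qed
qed

text \<open>Induction on the coordinates. If some \<open>r\<close> in \<open>A\<close> shares the
  new coordinate with \<open>v\<close>, then \<open>v - r\<close> is separated from the kernel of
  that coordinate and the functional is extended to \<open>A\<close>; otherwise a multiple of the
  new coordinate already separates.\<close>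

lemma padic_separation:
  fixes A :: "('i \<Rightarrow> 'p::prime_card padic) set"
  assumes "finite I" "zp_submodule V A" "\<And>a i. a \<in> A \<Longrightarrow> i \<notin> I \<Longrightarrow> a i = 0"
    "\<And>i. i \<notin> I \<Longrightarrow> v i = 0" "v \<notin> A"
  shows "\<exists>c. (\<forall>a\<in>A. (\<Sum>i\<in>I. c i * a i) \<in> \<int>\<^sub>p) \<and> (\<Sum>i\<in>I. c i * v i) \<notin> \<int>\<^sub>p"
  using assms
proof (induction I arbitrary: A v)
  case empty
  then have "v = 0" by auto
  then show ?case using empty zp_submodule_0 by blast
next
  case (insert i I)
  note A = insert.prems(1)
  let ?p = "of_nat CARD('p) :: 'p padic"
  have upd: "(\<Sum>j\<in>insert i I. (c(i := \<gamma>)) j * a j) = \<gamma> * a i + (\<Sum>j\<in>I. c j * a j)"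
    for c \<gamma> and a :: "'i \<Rightarrow> 'p padic"
  proof -
    have "(\<Sum>j\<in>I. (c(i := \<gamma>)) j * a j) = (\<Sum>j\<in>I. c j * a j)"
      using insert.hyps(2) by (intro sum.cong) auto
    then show ?thesis using insert.hyps by simp
  qed
  show ?case
  proof (cases "\<exists>r\<in>A. r i = v i")
    case True
    then obtain r where r: "r \<in> A" "r i = v i" by blast
    let ?A = "{a \<in> A. a i = 0}"
    have A': "zp_submodule V ?A"
      using A zp_submodule_add[OF A] zp_submodule_scale[OF A] zp_submodule_0[OF A]
      by (intro zp_submoduleI) (auto simp: zp_submodule_def)
    have "v - r \<notin> ?A" using zp_submodule_add[OF A _ r(1), of "v - r"] insert.prems(4) by auto
    moreover have "(v - r) j = 0" if "j \<notin> I" for j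
      using that r insert.prems(2)[OF r(1), of j] insert.prems(3)[of j] by (cases "j = i") auto
    moreover have "a j = 0" if "a \<in> ?A" "j \<notin> I" for a j
      using that insert.prems(2)[of a j] by (cases "j = i") auto
    ultimately obtain c where c: "\<forall>a\<in>?A. (\<Sum>j\<in>I. c j * a j) \<in> \<int>\<^sub>p"
        "(\<Sum>j\<in>I. c j * (v - r) j) \<notin> \<int>\<^sub>p"
      using insert.IH[OF A', of "v - r"] by blast
    define \<phi> where "\<phi> a = (\<Sum>j\<in>I. c j * a j)" for a
    have \<phi>: "\<phi> (a - b) = \<phi> a - \<phi> b" "\<phi> (\<lambda>i. t * a i) = t * \<phi> a" for a b t
      by (simp_all add: \<phi>_def right_diff_distrib sum_subtractf sum_distrib_left mult_ac)
    obtain \<gamma> where \<gamma>: "\<forall>a\<in>A. \<gamma> * a i + \<phi> a \<in> \<int>\<^sub>p"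
      using integral_functional_extend[OF A, of \<phi> i] \<phi> c(1) by (auto simp: \<phi>_def)
    \<comment> \<open>The extended functional is integral at \<open>r\<close> and equals \<phi> at
      \<open>v - r\<close>, so it cannot be integral at \<open>v\<close>.\<close>
    have "\<gamma> * v i + \<phi> v \<notin> \<int>\<^sub>p"
    proof
      assume "\<gamma> * v i + \<phi> v \<in> \<int>\<^sub>p"
      from padic_ints_diff[OF this bspec[OF \<gamma> r(1)]] have "\<phi> (v - r) \<in> \<int>\<^sub>p"
        by (simp add: r(2) \<phi>(1))
      then show False using c(2) by (simp add: \<phi>_def)
    qed
    with \<gamma> show ?thesis unfolding upd[symmetric] \<phi>_def by blast
  next
    case False
    then have vi: "v i \<noteq> 0" using zp_submodule_0[OF A] by force
    have "\<exists>\<gamma>. (\<forall>a\<in>A. \<gamma> * a i \<in> \<int>\<^sub>p) \<and> \<gamma> * v i \<notin> \<int>\<^sub>p"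
      using A
    proof (cases rule: zp_submodule_coordinate_cases[where i = i])
      \<comment> \<open>The functional vanishes on \<open>A\<close> and takes the non-integral value
        1/p at \<open>v\<close>.\<close>
      case zero
      then show ?thesis using vi inverse_CARD_nonint[where 'p = 'p]
        by (intro exI[of _ "inverse ?p / v i"]) auto
    next
      case (lattice a0)
      have "v i / a0 i \<notin> \<int>\<^sub>p"
        using False zp_submodule_scale[OF A lattice(1), of "v i / a0 i"] lattice(2) by force
      with lattice show ?thesis by (intro exI[of _ "inverse (a0 i)"]) (auto simp: field_simps)
    next
      \<comment> \<open>This case is contradictory: the coordinate maps \<open>A\<close> onto Q_p
        and would attain \<open>v i\<close>.\<close>
      case (line q f)
      obtain n where "?p ^ n * (v i / q) \<in> \<int>\<^sub>p" using padic_scale_int by blast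
      from zp_submodule_scale[OF A line(2) this, of n] False line(1,3) show ?thesis by force
    qed
    then obtain \<gamma> where \<gamma>: "\<forall>a\<in>A. \<gamma> * a i \<in> \<int>\<^sub>p" "\<gamma> * v i \<notin> \<int>\<^sub>p" by blast
    then show ?thesis using upd[of "\<lambda>_. 0" \<gamma>] by (intro exI[of _ "(\<lambda>_. 0)(i := \<gamma>)"]) simp
  qed
qed

section \<open>Duality for the standard forms\<close>

text \<open>The index type is left general so that one formula serves both \<open>std_form\<close>
  and the form on the large space on which the matrices act.\<close>

definition sym_form :: "'c set \<Rightarrow> ('c + 'c \<Rightarrow> 'p::prime_card padic) \<Rightarrow> ('c + 'c \<Rightarrow> 'p padic) \<Rightarrow> 'p padic" where
  "sym_form J a b = (\<Sum>c\<in>J. a (Inl c) * b (Inr c) - a (Inr c) * b (Inl c))"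

lemma std_form_eq_sym_form: "std_form n = sym_form {..<n}"
  by (intro ext) (simp add: std_form_def sym_form_def)

lemma sym_form_add_left: "sym_form J (a + a') b = sym_form J a b + sym_form J a' b"
  by (simp add: sym_form_def algebra_simps flip: sum.distrib)

lemma sym_form_add_right: "sym_form J a (b + b') = sym_form J a b + sym_form J a b'"
  by (simp add: sym_form_def algebra_simps flip: sum.distrib)

lemma sym_form_diff_right: "sym_form J a (b - b') = sym_form J a b - sym_form J a b'"
  by (simp add: sym_form_def algebra_simps flip: sum.distrib sum_subtractf)

lemma sym_form_scale_left: "sym_form J (\<lambda>i. t * a i) b = t * sym_form J a b"
  by (simp add: sym_form_def algebra_simps sum_distrib_left)

lemma sym_form_scale_right: "sym_form J a (\<lambda>i. t * b i) = t * sym_form J a b"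
  by (simp add: sym_form_def algebra_simps sum_distrib_left)

lemma sym_form_swap: "sym_form J a b = - sym_form J b a"
  by (simp add: sym_form_def algebra_simps flip: sum_negf)

lemma sym_form_self [simp]: "sym_form J a a = 0"
  by (simp add: sym_form_def mult.commute)

lemma sym_form_zero [simp]: "sym_form J a 0 = 0" "sym_form J 0 b = 0"
  by (simp_all add: sym_form_def)

lemma std_space_closed:
  "0 \<in> std_space n" "u \<in> std_space n \<Longrightarrow> v \<in> std_space n \<Longrightarrow> u + v \<in> std_space n"
  "u \<in> std_space n \<Longrightarrow> (\<lambda>i. c * u i) \<in> std_space n"
  by (simp_all add: std_space_def)

text \<open>Adjoining \<open>v\<close> to \<open>R\<close> keeps it isotropic, because the form is
  alternating and \<open>v\<close> pairs integrally with \<open>R\<close>; maximality then forces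
  \<open>v\<close> into \<open>R\<close>.\<close>

lemma self_dual_std_dual:
  fixes R :: "(nat + nat \<Rightarrow> 'p::prime_card padic) set"
  assumes R: "self_dual (std_space n) (std_form n) R"
    and v: "v \<in> std_space n" and int: "\<And>w. w \<in> R \<Longrightarrow> std_form n v w \<in> \<int>\<^sub>p"
  shows "v \<in> R"
proof -
  have R_sub: "zp_submodule (std_space n) R" and R_int: "\<And>r r'. r \<in> R \<Longrightarrow> r' \<in> R \<Longrightarrow> std_form n r r' \<in> \<int>\<^sub>p"
    using R by (auto simp: self_dual_def isotropic_def)
  define R' where "R' = {r + (\<lambda>i. s * v i) | r s. r \<in> R \<and> s \<in> \<int>\<^sub>p}"
  have R'I: "r + (\<lambda>i. s * v i) \<in> R'" if "r \<in> R" "s \<in> \<int>\<^sub>p" for r s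
    using that by (auto simp: R'_def)
  have sub: "zp_submodule (std_space n) R'"
  proof (rule zp_submoduleI)
    show "R' \<subseteq> std_space n"
      using R_sub v by (auto simp: R'_def zp_submodule_def std_space_closed subset_iff)
    show "0 \<in> R'" using R'I[OF zp_submodule_0[OF R_sub] padic_ints_0] by (simp add: zero_fun_def plus_fun_def)
  next
    fix f f' assume "f \<in> R'" "f' \<in> R'"
    then obtain r s r' s' where *: "r \<in> R" "s \<in> \<int>\<^sub>p" "r' \<in> R" "s' \<in> \<int>\<^sub>p"
      "f = r + (\<lambda>i. s * v i)" "f' = r' + (\<lambda>i. s' * v i)" by (auto simp: R'_def)
    have "f + f' = (r + r') + (\<lambda>i. (s + s') * v i)" by (simp add: * fun_eq_iff algebra_simps)
    then show "f + f' \<in> R'" using R'I * zp_submodule_add[OF R_sub] padic_ints_add by metis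
  next
    fix c f assume "f \<in> R'" "c \<in> (\<int>\<^sub>p :: 'p padic set)"
    then obtain r s where *: "r \<in> R" "s \<in> \<int>\<^sub>p" "c \<in> (\<int>\<^sub>p :: 'p padic set)" "f = r + (\<lambda>i. s * v i)"
      by (auto simp: R'_def)
    have "(\<lambda>i. c * f i) = (\<lambda>i. c * r i) + (\<lambda>i. (c * s) * v i)" by (simp add: * fun_eq_iff algebra_simps)
    then show "(\<lambda>i. c * f i) \<in> R'" using R'I * zp_submodule_scale[OF R_sub] padic_ints_mult by metis
  qed
  moreover have "std_form n f f' \<in> \<int>\<^sub>p" if "f \<in> R'" "f' \<in> R'" for f f'
  proof -
    obtain r s r' s' where *: "r \<in> R" "s \<in> \<int>\<^sub>p" "r' \<in> R" "s' \<in> \<int>\<^sub>p"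
      "f = r + (\<lambda>i. s * v i)" "f' = r' + (\<lambda>i. s' * v i)" using \<open>f \<in> R'\<close> \<open>f' \<in> R'\<close> by (auto simp: R'_def)
    have "std_form n f f' = std_form n r r' + s * std_form n v r' - s' * std_form n v r"
      unfolding *(5,6) std_form_eq_sym_form sym_form_add_left sym_form_add_right
        sym_form_scale_left sym_form_scale_right
      by (simp add: sym_form_swap[of _ r v])
    then show ?thesis using * R_int int by (auto intro!: padic_ints_add padic_ints_diff padic_ints_mult)
  qed
  ultimately have "isotropic (std_space n) (std_form n) R'" by (simp add: isotropic_def)
  moreover have "R \<subseteq> R'"
  proof
    fix r assume "r \<in> R"
    from R'I[OF this padic_ints_0] show "r \<in> R'" by (simp add: plus_fun_def)
  qed
  ultimately have "R' = R" using R by (simp add: self_dual_def)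
  moreover have "v \<in> R'"
    using R'I[OF zp_submodule_0[OF R_sub] padic_ints_1] by (simp add: plus_fun_def)
  ultimately show ?thesis by simp
qed

text \<open>Each element of an isotropic overmodule pairs integrally with \<open>R\<close>, hence
  lies in \<open>R\<close> already.\<close>

lemma self_dualI:
  assumes "isotropic V B R" "\<And>v. v \<in> V \<Longrightarrow> (\<And>w. w \<in> R \<Longrightarrow> B w v \<in> \<int>\<^sub>p) \<Longrightarrow> v \<in> R"
  shows "self_dual V B R"
  unfolding self_dual_def
proof (intro conjI allI impI, fact assms(1))
  fix R' assume R': "isotropic V B R' \<and> R \<subseteq> R'"
  then have "v \<in> V" "\<And>w. w \<in> R \<Longrightarrow> B w v \<in> \<int>\<^sub>p" if "v \<in> R'" for v
    using that by (auto simp: isotropic_def zp_submodule_def)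
  with R' assms(2) show "R' = R" by blast
qed

section \<open>The symplectic action of a matrix\<close>

text \<open>Regroups the coordinates into a plus half and a minus half, each indexed like the
  columns of a matrix in \<open>GL_inf\<close>, so that \<open>act\<close> is block
  diagonal.\<close>

definition join ::
  "(nat + nat \<Rightarrow> 'p::prime_card padic) \<Rightarrow> (nat \<times> nat + nat \<times> nat \<Rightarrow> 'p padic) \<Rightarrow> idx + idx \<Rightarrow> 'p padic" where
  "join u x = case_sum (case_sum (u \<circ> Inl) (x \<circ> Inl)) (case_sum (u \<circ> Inr) (x \<circ> Inr))"

definition act ::
  "('c \<Rightarrow> 'c \<Rightarrow> 'p::prime_card padic) \<Rightarrow> ('c \<Rightarrow> 'c \<Rightarrow> 'p padic) \<Rightarrow> ('c + 'c \<Rightarrow> 'p padic) \<Rightarrow> 'c + 'c \<Rightarrow> 'p padic"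
  where "act g h a = case_sum (mat_vec g (a \<circ> Inl)) (mat_vec h (a \<circ> Inr))"

lemma case_sum_eq_iff: "case_sum f g = case_sum f' g' \<longleftrightarrow> f = f' \<and> g = g'"
  by (metis case_sum_o_inj(1,2))

lemma join_apply [simp]:
  "join u x (Inl (Inl i)) = u (Inl i)" "join u x (Inl (Inr j)) = x (Inl j)"
  "join u x (Inr (Inl i)) = u (Inr i)" "join u x (Inr (Inr j)) = x (Inr j)"
  by (simp_all add: join_def)

lemma join_eqI:
  assumes "\<And>i. a (Inl (Inl i)) = u (Inl i)" "\<And>j. a (Inl (Inr j)) = x (Inl j)"
    "\<And>i. a (Inr (Inl i)) = u (Inr i)" "\<And>j. a (Inr (Inr j)) = x (Inr j)"
  shows "a = join u x"
  by (rule ext) (auto simp: assms join_def split: sum.split)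

lemma join_add: "join u x + join u' x' = join (u + u') (x + x')"
  by (rule join_eqI) simp_all

lemma join_diff: "join u x - join u' x' = join (u - u') (x - x')"
  by (rule join_eqI) simp_all

lemma join_scale: "(\<lambda>i. c * join u x i) = join (\<lambda>i. c * u i) (\<lambda>i. c * x i)"
  by (rule join_eqI) simp_all

lemma join_0 [simp]: "join 0 0 = 0"
  by (rule join_eqI[symmetric]) simp_all

lemma slice_add: "slice i (x + y) = slice i x + slice i y"
  by (auto simp: slice_def fun_eq_iff split: sum.splits)

lemma slice_scale: "slice i (\<lambda>j. c * x j) = (\<lambda>j. c * slice i x j)"
  by (auto simp: slice_def fun_eq_iff split: sum.splits)

lemma slice_0 [simp]: "slice i 0 = 0"
  by (auto simp: slice_def fun_eq_iff split: sum.splits)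

lemma zp_submodule_tensor_Zp:
  assumes "zp_submodule V Q"
  shows "zp_submodule UNIV (tensor_Zp m Q)"
  using zp_submodule_0[OF assms] zp_submodule_add[OF assms] zp_submodule_scale[OF assms]
  by (intro zp_submoduleI) (auto simp: tensor_Zp_def slice_add slice_scale)

text \<open>The large space is the orthogonal sum of \<V> and m copies of \<H>, one for each
  slice.\<close>

lemma sym_form_join:
  "sym_form (idx_upto \<alpha> k m) (join u x) (join u' x') =
    std_form \<alpha> u u' + (\<Sum>i<m. std_form k (slice i x) (slice i x'))"
proof -
  have "(\<Sum>i<m. std_form k (slice i x) (slice i x')) =
      (\<Sum>j<k. \<Sum>i<m. x (Inl (j, i)) * x' (Inr (j, i)) - x (Inr (j, i)) * x' (Inl (j, i)))"
    unfolding std_form_def slice_def by (subst sum.swap) simp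
  then show ?thesis by (simp add: sym_form_def sum_idx_upto std_form_def)
qed

text \<open>Used to read vectors obtained from separation, known only by their support, as
  pairs.\<close>

lemma vanishing_eq_join:
  fixes a :: "idx + idx \<Rightarrow> 'p::prime_card padic"
  assumes "\<And>c. c \<notin> idx_upto \<alpha> k m \<Longrightarrow> a (Inl c) = 0 \<and> a (Inr c) = 0"
  obtains u x where "a = join u x" "u \<in> std_space \<alpha>"
    "\<And>i. i < m \<Longrightarrow> slice i x \<in> std_space k" "\<And>i. i \<ge> m \<Longrightarrow> slice i x = 0"
proof
  let ?u = "case_sum (\<lambda>i. a (Inl (Inl i))) (\<lambda>i. a (Inr (Inl i)))"
  let ?x = "case_sum (\<lambda>i. a (Inl (Inr i))) (\<lambda>i. a (Inr (Inr i)))"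
  show "a = join ?u ?x" by (rule join_eqI) simp_all
  have l: "a (Inl (Inl i)) = 0 \<and> a (Inr (Inl i)) = 0" if "i \<ge> \<alpha>" for i
    using that by (intro assms) (auto simp: idx_upto_def)
  have r: "a (Inl (Inr (j, i))) = 0 \<and> a (Inr (Inr (j, i))) = 0" if "j \<ge> k \<or> i \<ge> m" for i j
    using that by (intro assms) (auto simp: idx_upto_def)
  show "?u \<in> std_space \<alpha>" by (simp add: std_space_def l)
  show "slice i ?x \<in> std_space k" for i by (simp add: slice_def std_space_def r)
  show "slice i ?x = 0" if "i \<ge> m" for i
    using that by (simp add: slice_def fun_eq_iff r split: sum.split)
qed

text \<open>The vectors may have infinite support; the finite support of the matrix is what reduces
  \<open>Sum_any\<close> to finite sums.\<close>

lemma mat_vec_linear: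
  assumes "g \<in> carrier (GL_inf \<alpha> k)"
  shows "mat_vec g (a + b) = mat_vec g a + mat_vec g b" "mat_vec g (\<lambda>i. c * a i) = (\<lambda>i. c * mat_vec g a i)"
proof -
  obtain M where "supported (idx_upto \<alpha> k M) g"
    using GL_inf_finitary[OF assms] unfolding finitary_carrier_iff by blast
  note mv = mat_vec_eq[OF finite_idx_upto this]
  show "mat_vec g (a + b) = mat_vec g a + mat_vec g b"
    by (rule ext) (simp add: mv algebra_simps sum.distrib)
  show "mat_vec g (\<lambda>i. c * a i) = (\<lambda>i. c * mat_vec g a i)"
    by (rule ext) (simp add: mv algebra_simps sum_distrib_left)
qed

lemma mat_vec_adjoint:
  assumes J: "finite J" "supported J g"
  shows "(\<Sum>c\<in>J. mat_vec g a c * b c) = (\<Sum>c\<in>J. a c * mat_vec (mat_transpose g) b c)"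
proof -
  have "(\<Sum>c\<in>J. mat_vec g a c * b c) = (\<Sum>c\<in>J. \<Sum>d\<in>J. g c d * a d * b c)"
    by (simp add: mat_vec_eq[OF J] sum_distrib_right)
  also have "\<dots> = (\<Sum>d\<in>J. \<Sum>c\<in>J. g c d * a d * b c)" by (rule sum.swap)
  also have "\<dots> = (\<Sum>c\<in>J. a c * mat_vec (mat_transpose g) b c)"
    by (simp add: mat_vec_eq[OF J(1) supported_transpose[OF J(2)]] sum_distrib_left)
      (simp add: mat_transpose_def mult_ac)
  finally show ?thesis .
qed

section \<open>The characteristic function on self-dual submodules\<close>

lemma act_linear:
  assumes "g \<in> carrier (GL_inf \<alpha> k)" "h \<in> carrier (GL_inf \<alpha> k)"
  shows "act g h (a + b) = act g h a + act g h b" "act g h (\<lambda>i. c * a i) = (\<lambda>i. c * act g h a i)"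
proof -
  have o: "(a + b) \<circ> F = (a \<circ> F) + (b \<circ> F)" "(\<lambda>i. c * a i) \<circ> F = (\<lambda>i. c * (a \<circ> F) i)" for F :: "idx \<Rightarrow> idx + idx"
    by (auto simp: fun_eq_iff)
  show "act g h (a + b) = act g h a + act g h b" "act g h (\<lambda>i. c * a i) = (\<lambda>i. c * act g h a i)"
    unfolding act_def o mat_vec_linear[OF assms(1)] mat_vec_linear[OF assms(2)]
    by (simp_all add: fun_eq_iff comp_def split: sum.split)
qed

section \<open>The symplectic operator \<open>G\<close> of a fixed representative\<close>

locale char_fun =
  fixes \<alpha> k m :: nat and g :: "idx \<Rightarrow> idx \<Rightarrow> 'p::prime_card padic"
  assumes g_GL_fin: "g \<in> GL_fin \<alpha> k m"
begin

abbreviation "J \<equiv> idx_upto \<alpha> k m"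

definition "G = act g (inv\<^bsub>GL_inf \<alpha> k\<^esub> (mat_transpose g))"

lemma g_GL: "g \<in> carrier (GL_inf \<alpha> k)" and g_supp: "supported J g"
  using g_GL_fin by (auto simp: GL_fin_def)

lemmas gt_GL = GL_inf_transpose[OF g_GL]

lemma inv_GL: "f \<in> carrier (GL_inf \<alpha> k) \<Longrightarrow> inv\<^bsub>GL_inf \<alpha> k\<^esub> f \<in> carrier (GL_inf \<alpha> k)"
  by (rule group.inv_closed[OF group_GL_inf])

lemmas G_add = act_linear(1)[OF g_GL inv_GL[OF gt_GL], folded G_def]
lemmas G_scale = act_linear(2)[OF g_GL inv_GL[OF gt_GL], folded G_def]

lemma G_0 [simp]: "G 0 = 0"
  using G_scale[of 0 0] by (simp add: zero_fun_def)

lemma inv_transpose_cancel: "mat_vec (mat_transpose g) (mat_vec (inv\<^bsub>GL_inf \<alpha> k\<^esub> (mat_transpose g)) w) = w"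
  using mat_vec_inv_iff[OF gt_GL] by blast

text \<open>Each term pairs a plus half with a minus half; moving \<open>g\<close> across as its
  transpose cancels the inverse transpose there.\<close>

lemma G_preserves_form: "sym_form J (G a) (G b) = sym_form J a b"
proof -
  note adj = mat_vec_adjoint[OF finite_idx_upto g_supp]
  have "sym_form J (G a) (G b) = (\<Sum>c\<in>J. mat_vec g (a \<circ> Inl) c * G b (Inr c)) -
      (\<Sum>c\<in>J. mat_vec g (b \<circ> Inl) c * G a (Inr c))"
    by (simp add: sym_form_def G_def act_def sum_subtractf mult.commute)
  also have "\<dots> = sym_form J a b"
    unfolding adj by (simp add: sym_form_def G_def act_def inv_transpose_cancel sum_subtractf mult.commute)
  finally show ?thesis .
qed

lemma G_surj:
  assumes e: "\<And>c. c \<notin> J \<Longrightarrow> e (Inl c) = 0 \<and> e (Inr c) = 0"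
  obtains e' where "G e' = e" "\<And>c. c \<notin> J \<Longrightarrow> e' (Inl c) = 0 \<and> e' (Inr c) = 0"
proof
  let ?e = "case_sum (mat_vec (inv\<^bsub>GL_inf \<alpha> k\<^esub> g) (e \<circ> Inl)) (mat_vec (mat_transpose g) (e \<circ> Inr))"
  have 1: "mat_vec g (mat_vec (inv\<^bsub>GL_inf \<alpha> k\<^esub> g) w) = w" for w
    using mat_vec_inv_iff[OF g_GL] by blast
  have "mat_vec (inv\<^bsub>GL_inf \<alpha> k\<^esub> (mat_transpose g)) (mat_vec (mat_transpose g) w) = w" for w
    using mat_vec_inv_iff[OF gt_GL] by metis
  with 1 show "G ?e = e"
    by (auto simp: G_def act_def comp_def fun_eq_iff split: sum.split)
  \<comment> \<open>No support bound for the inverse is at hand; but \<open>g\<close> fixes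
    coordinates off \<open>J\<close>, so \<open>1\<close> shows that the preimage agrees with
    \<open>e\<close> there.\<close>
  show "?e (Inl c) = 0 \<and> ?e (Inr c) = 0" if "c \<notin> J" for c
    using that e[OF that] fun_cong[OF 1[of "e \<circ> Inl"], of c]
    by (simp add: mat_vec_eq[OF finite_idx_upto g_supp] mat_vec_eq[OF finite_idx_upto supported_transpose[OF g_supp]])
qed

section \<open>The characteristic function as a monotone map into submodules\<close>

lemma mem_chi_rep_iff:
  "case_sum u v \<in> chi_rep \<alpha> k m g Q T \<longleftrightarrow> u \<in> std_space \<alpha> \<and> v \<in> std_space \<alpha> \<and>
    (\<exists>x\<in>tensor_Zp m Q. \<exists>y\<in>tensor_Zp m T. join v y = G (join u x))"
  by (auto simp: chi_rep_def join_def G_def act_def case_sum_eq_iff case_sum_o_inj)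

lemma chi_repE:
  assumes "w \<in> chi_rep \<alpha> k m g Q T"
  obtains u v x y where "w = case_sum u v" "u \<in> std_space \<alpha>" "v \<in> std_space \<alpha>"
    "x \<in> tensor_Zp m Q" "y \<in> tensor_Zp m T" "join v y = G (join u x)"
proof -
  obtain u v where w: "w = case_sum u v" using assms unfolding chi_rep_def by blast
  with assms show thesis using that by (auto simp: mem_chi_rep_iff)
qed

lemma chi_rep_mono: "Q' \<subseteq> Q \<Longrightarrow> T' \<subseteq> T \<Longrightarrow> chi_rep \<alpha> k m g Q' T' \<subseteq> chi_rep \<alpha> k m g Q T"
proof
  fix w assume sub: "Q' \<subseteq> Q" "T' \<subseteq> T" and "w \<in> chi_rep \<alpha> k m g Q' T'"
  then obtain u v x y where *: "w = case_sum u v" "u \<in> std_space \<alpha>" "v \<in> std_space \<alpha>"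
    "x \<in> tensor_Zp m Q'" "y \<in> tensor_Zp m T'" "join v y = G (join u x)" by (elim chi_repE)
  then have "x \<in> tensor_Zp m Q" "y \<in> tensor_Zp m T" using sub by (auto simp: tensor_Zp_def)
  with * show "w \<in> chi_rep \<alpha> k m g Q T" by (auto simp: mem_chi_rep_iff)
qed

lemma zp_submodule_chi_rep:
  assumes Q: "zp_submodule (std_space k) Q" and T: "zp_submodule (std_space k) T"
  shows "zp_submodule (dbl_space \<alpha>) (chi_rep \<alpha> k m g Q T)"
proof (rule zp_submoduleI)
  note Qm = zp_submodule_tensor_Zp[OF Q, of m] and Tm = zp_submodule_tensor_Zp[OF T, of m]
  show "chi_rep \<alpha> k m g Q T \<subseteq> dbl_space \<alpha>" by (auto simp: chi_rep_def dbl_space_def)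
  have "case_sum 0 0 \<in> chi_rep \<alpha> k m g Q T"
    unfolding mem_chi_rep_iff using zp_submodule_0[OF Qm] zp_submodule_0[OF Tm]
    by (auto simp: std_space_closed intro!: bexI[of _ 0])
  also have "case_sum 0 0 = (0 :: (nat + nat) + (nat + nat) \<Rightarrow> 'p padic)"
    by (auto simp: fun_eq_iff split: sum.split)
  finally show "0 \<in> chi_rep \<alpha> k m g Q T" .
next
  note Qm = zp_submodule_tensor_Zp[OF Q, of m] and Tm = zp_submodule_tensor_Zp[OF T, of m]
  fix w w' assume "w \<in> chi_rep \<alpha> k m g Q T" "w' \<in> chi_rep \<alpha> k m g Q T"
  then obtain u v x y u' v' x' y' where *: "w = case_sum u v" "u \<in> std_space \<alpha>" "v \<in> std_space \<alpha>"
      "x \<in> tensor_Zp m Q" "y \<in> tensor_Zp m T" "join v y = G (join u x)"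
    and **: "w' = case_sum u' v'" "u' \<in> std_space \<alpha>" "v' \<in> std_space \<alpha>"
      "x' \<in> tensor_Zp m Q" "y' \<in> tensor_Zp m T" "join v' y' = G (join u' x')"
    by (elim chi_repE)
  have "join (v + v') (y + y') = G (join (u + u') (x + x'))"
    using *(6) **(6) by (simp add: G_add flip: join_add)
  then have "case_sum (u + u') (v + v') \<in> chi_rep \<alpha> k m g Q T"
    unfolding mem_chi_rep_iff
    using * ** std_space_closed(2) zp_submodule_add[OF Qm] zp_submodule_add[OF Tm] by blast
  also have "case_sum (u + u') (v + v') = w + w'"
    unfolding *(1) **(1) by (auto simp: fun_eq_iff split: sum.split)
  finally show "w + w' \<in> chi_rep \<alpha> k m g Q T" .
next
  note Qm = zp_submodule_tensor_Zp[OF Q, of m] and Tm = zp_submodule_tensor_Zp[OF T, of m]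
  fix c w assume c: "c \<in> (\<int>\<^sub>p :: 'p padic set)" and "w \<in> chi_rep \<alpha> k m g Q T"
  then obtain u v x y where *: "w = case_sum u v" "u \<in> std_space \<alpha>" "v \<in> std_space \<alpha>"
    "x \<in> tensor_Zp m Q" "y \<in> tensor_Zp m T" "join v y = G (join u x)" by (elim chi_repE)
  have "join (\<lambda>i. c * v i) (\<lambda>i. c * y i) = G (join (\<lambda>i. c * u i) (\<lambda>i. c * x i))"
    using *(6) by (simp add: G_scale flip: join_scale)
  then have "case_sum (\<lambda>i. c * u i) (\<lambda>i. c * v i) \<in> chi_rep \<alpha> k m g Q T"
    unfolding mem_chi_rep_iff
    using * c std_space_closed(3) zp_submodule_scale[OF Qm] zp_submodule_scale[OF Tm] by blast
  also have "case_sum (\<lambda>i. c * u i) (\<lambda>i. c * v i) = (\<lambda>i. c * w i)"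
    unfolding *(1) by (auto simp: fun_eq_iff split: sum.split)
  finally show "(\<lambda>i. c * w i) \<in> chi_rep \<alpha> k m g Q T" .
qed

section \<open>Duality for the values of the characteristic function\<close>

lemma dbl_form_case_sum: "dbl_form n (case_sum u v) (case_sum u' v') = std_form n u u' - std_form n v v'"
  by (simp add: dbl_form_def case_sum_o_inj)

text \<open>Invariance under \<open>G\<close> equates the total forms before and after; the minus
  sign in \<open>dbl_form\<close> leaves only the \<H>-parts.\<close>

lemma dbl_form_G:
  assumes "join v y = G (join u x)" "join v' y' = G (join u' x')"
  shows "dbl_form \<alpha> (case_sum u v) (case_sum u' v') =
    (\<Sum>i<m. std_form k (slice i y) (slice i y')) - (\<Sum>i<m. std_form k (slice i x) (slice i x'))"
  using G_preserves_form[of "join u x" "join u' x'"] unfolding assms[symmetric] sym_form_join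
  by (simp add: dbl_form_case_sum algebra_simps)

text \<open>
  If \<open>(u, v)\<close> is orthogonal to \<open>\<chi>(Q, T)\<close>, then \<open>(v, 0) - G (u, 0)\<close> lies in the submodule
  \<open>G (0 \<oplus> Q \<otimes> \<int>\<^sub>p\<^sup>m) + (0 \<oplus> T \<otimes> \<int>\<^sub>p\<^sup>m)\<close>, which says \<open>(u, v) \<in> \<chi>(Q, T)\<close>: a vector separating
  the two would give an element of \<open>\<chi>(Q, T)\<close> that is not orthogonal to \<open>(u, v)\<close>.
\<close>

lemma chi_rep_dual:
  assumes Q: "self_dual (std_space k) (std_form k) Q" and T: "self_dual (std_space k) (std_form k) T"
    and u: "u \<in> std_space \<alpha>" and v: "v \<in> std_space \<alpha>"
    and dual: "\<And>w. w \<in> chi_rep \<alpha> k m g Q T \<Longrightarrow> dbl_form \<alpha> w (case_sum u v) \<in> \<int>\<^sub>p"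
  shows "case_sum u v \<in> chi_rep \<alpha> k m g Q T"
proof (rule ccontr)
  assume notin: "case_sum u v \<notin> chi_rep \<alpha> k m g Q T"
  have Qs: "zp_submodule (std_space k) Q" and Ts: "zp_submodule (std_space k) T"
    using Q T by (auto simp: self_dual_def isotropic_def)
  note Qm = zp_submodule_tensor_Zp[OF Qs, of m] and Tm = zp_submodule_tensor_Zp[OF Ts, of m]
  define M where "M = {G (join 0 x) + join 0 y | x y. x \<in> tensor_Zp m Q \<and> y \<in> tensor_Zp m T}"
  define f where "f = join v 0 - G (join u 0)"
  have MI: "G (join 0 x) + join 0 y \<in> M" if "x \<in> tensor_Zp m Q" "y \<in> tensor_Zp m T" for x y
    using that by (auto simp: M_def)
  have M_sub: "zp_submodule UNIV M"
  proof (rule zp_submoduleI)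
    show "0 \<in> M" using MI[OF zp_submodule_0[OF Qm] zp_submodule_0[OF Tm]] by simp
  next
    fix a b assume "a \<in> M" "b \<in> M"
    then obtain x y x' y' where *: "x \<in> tensor_Zp m Q" "y \<in> tensor_Zp m T" "x' \<in> tensor_Zp m Q" "y' \<in> tensor_Zp m T"
      "a = G (join 0 x) + join 0 y" "b = G (join 0 x') + join 0 y'" by (auto simp: M_def)
    have "join 0 (x + x') = join 0 x + join 0 x'" "join 0 (y + y') = join 0 y + join 0 y'"
      by (simp_all add: join_add)
    then have "a + b = G (join 0 (x + x')) + join 0 (y + y')"
      by (simp add: * G_add)
    then show "a + b \<in> M" using MI * zp_submodule_add[OF Qm] zp_submodule_add[OF Tm] by metis
  next
    fix c a assume c: "c \<in> (\<int>\<^sub>p :: 'p padic set)" and "a \<in> M"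
    then obtain x y where *: "x \<in> tensor_Zp m Q" "y \<in> tensor_Zp m T"
      "a = G (join 0 x) + join 0 y" by (auto simp: M_def)
    have j: "join 0 (\<lambda>i. c * x i) = (\<lambda>i. c * join 0 x i)" "join 0 (\<lambda>i. c * y i) = (\<lambda>i. c * join 0 y i)"
      by (simp_all add: join_scale zero_fun_def)
    have "(\<lambda>i. c * a i) = G (join 0 (\<lambda>i. c * x i)) + join 0 (\<lambda>i. c * y i)"
      unfolding j G_scale *(3) by (simp add: fun_eq_iff algebra_simps)
    then show "(\<lambda>i. c * a i) \<in> M" using MI * c zp_submodule_scale[OF Qm] zp_submodule_scale[OF Tm] by metis
  qed simp
  have "f \<notin> M"
  proof
    assume "f \<in> M"
    then obtain x y where *: "x \<in> tensor_Zp m Q" "y \<in> tensor_Zp m T" "f = G (join 0 x) + join 0 y"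
      by (auto simp: M_def)
    \<comment> \<open>Membership in \<open>M\<close> adds \<open>y\<close>, so \<open>- y\<close> is
      the witness in \<open>T\<close> required by the relation.\<close>
    have "join v (- y) = join v 0 - join 0 y" by (simp add: join_diff)
    also have "\<dots> = G (join u 0) + G (join 0 x)" using *(3) by (simp add: f_def algebra_simps)
    also have "\<dots> = G (join u x)" by (simp add: join_add flip: G_add)
    finally have "join v (- y) = G (join u x)" .
    moreover have "- y \<in> tensor_Zp m T"
      using zp_submodule_diff[OF Tm zp_submodule_0[OF Tm] *(2)] by simp
    ultimately show False using notin u v *(1) by (auto simp: mem_chi_rep_iff)
  qed
  have supp_join: "join u x (Inl c) = 0 \<and> join u x (Inr c) = 0"
    if "u \<in> std_space \<alpha>" "x \<in> tensor_Zp m R" "zp_submodule (std_space k) R" "c \<notin> J" for u x R c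
  proof (cases c)
    case (Inl i)
    then have "i \<ge> \<alpha>" using that(4) by (auto simp: idx_upto_def)
    then show ?thesis using that(1) Inl by (simp add: std_space_def)
  next
    case (Inr z)
    then obtain j i where c: "c = Inr (j, i)" by (metis surj_pair)
    then have "j \<ge> k \<or> i \<ge> m" using that(4) by (auto simp: idx_upto_def)
    moreover have "slice i x = 0" if "i \<ge> m" using \<open>x \<in> tensor_Zp m R\<close> that by (simp add: tensor_Zp_def)
    moreover have "slice i x \<in> std_space k" if "i < m"
      using \<open>x \<in> tensor_Zp m R\<close> \<open>zp_submodule (std_space k) R\<close> that
      by (auto simp: tensor_Zp_def zp_submodule_def)
    ultimately have "slice i x (Inl j) = 0 \<and> slice i x (Inr j) = 0"
      by (cases "i < m") (auto simp: std_space_def)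
    then show ?thesis by (simp add: c slice_def)
  qed
  have supp_G: "G a (Inl c) = 0 \<and> G a (Inr c) = 0" if "a (Inl c) = 0 \<and> a (Inr c) = 0" "c \<notin> J" for a c
    using that(1) fun_cong[OF inv_transpose_cancel[of "a \<circ> Inr"], of c] that(2)
    by (simp add: G_def act_def mat_vec_eq[OF finite_idx_upto g_supp]
        mat_vec_eq[OF finite_idx_upto supported_transpose[OF g_supp]])
  have PlusI: "a s = 0" if "\<And>c. c \<notin> J \<Longrightarrow> a (Inl c) = 0 \<and> a (Inr c) = 0" "s \<notin> J <+> J"
    for a :: "idx + idx \<Rightarrow> 'p padic" and s
    using that by (cases s) (metis InlI, metis InrI)
  have supp_M: "a s = 0" if "a \<in> M" "s \<notin> J <+> J" for a s
  proof (rule PlusI[OF _ that(2)])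
    fix c assume c: "c \<notin> J"
    obtain x y where x: "x \<in> tensor_Zp m Q" and y: "y \<in> tensor_Zp m T"
      and a: "a = G (join 0 x) + join 0 y" using \<open>a \<in> M\<close> by (auto simp: M_def)
    show "a (Inl c) = 0 \<and> a (Inr c) = 0"
      using supp_G[of "join 0 x" c, OF supp_join[OF std_space_closed(1) x Qs c] c] supp_join[OF std_space_closed(1) y Ts c]
      by (simp add: a)
  qed
  have supp_f: "f s = 0" if "s \<notin> J <+> J" for s
  proof (rule PlusI[OF _ that])
    fix c assume c: "c \<notin> J"
    show "f (Inl c) = 0 \<and> f (Inr c) = 0"
      using supp_G[of "join u 0" c, OF supp_join[OF u zp_submodule_0[OF Qm] Qs c] c] supp_join[OF v zp_submodule_0[OF Qm] Qs c]
      by (simp add: f_def)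
  qed
  \<comment> \<open>\<open>f\<close> and all of \<open>M\<close> live on the finite coordinate set
    \<open>J <+> J\<close>, so separation applies.\<close>
  have "\<exists>c. (\<forall>a\<in>M. (\<Sum>s\<in>J <+> J. c s * a s) \<in> \<int>\<^sub>p) \<and> (\<Sum>s\<in>J <+> J. c s * f s) \<notin> \<int>\<^sub>p"
    by (rule padic_separation[where V = UNIV]) (simp_all add: M_sub supp_M supp_f \<open>f \<notin> M\<close>)
  then obtain c where c: "\<And>a. a \<in> M \<Longrightarrow> (\<Sum>s\<in>J <+> J. c s * a s) \<in> \<int>\<^sub>p" "(\<Sum>s\<in>J <+> J. c s * f s) \<notin> \<int>\<^sub>p"
    by blast
  \<comment> \<open>By nondegeneracy the separating functional is pairing with a vector: swap the
    halves of \<open>c\<close> and change one sign.\<close>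
  define e where "e = case_sum (\<lambda>s. if s \<in> J then c (Inr s) else 0) (\<lambda>s. if s \<in> J then - c (Inl s) else 0)"
  have e: "sym_form J e a = (\<Sum>s\<in>J <+> J. c s * a s)" for a
    by (simp add: sym_form_def e_def sum.Plus sum.distrib)
  have eM: "sym_form J e a \<in> \<int>\<^sub>p" if "a \<in> M" for a
    unfolding e using that by (rule c(1))
  have ef: "sym_form J e f \<notin> \<int>\<^sub>p"
    unfolding e by (rule c(2))
  have supp_e: "e (Inl s) = 0 \<and> e (Inr s) = 0" if "s \<notin> J" for s
    using that by (simp add: e_def)
  \<comment> \<open>Splitting \<open>e\<close> and its preimage \<open>e'\<close> into pairs gives
    (v', y') = G (u', x'), the candidate element of the characteristic function.\<close>
  obtain e' where e': "G e' = e" "\<And>s. s \<notin> J \<Longrightarrow> e' (Inl s) = 0 \<and> e' (Inr s) = 0"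
    by (rule G_surj[of e]) (use supp_e in blast)+
  obtain v' y' where vy: "e = join v' y'" "v' \<in> std_space \<alpha>"
    "\<And>i. i < m \<Longrightarrow> slice i y' \<in> std_space k" "\<And>i. i \<ge> m \<Longrightarrow> slice i y' = 0"
    by (rule vanishing_eq_join[of \<alpha> k m e]) (use supp_e in blast)+
  obtain u' x' where ux: "e' = join u' x'" "u' \<in> std_space \<alpha>"
    "\<And>i. i < m \<Longrightarrow> slice i x' \<in> std_space k" "\<And>i. i \<ge> m \<Longrightarrow> slice i x' = 0"
    by (rule vanishing_eq_join[of \<alpha> k m e']) (use e'(2) in blast)+
  \<comment> \<open>Test vectors concentrated in one copy of \<H>; pairing with them isolates a
    single slice.\<close>
  define single :: "nat \<Rightarrow> (nat + nat \<Rightarrow> 'p padic) \<Rightarrow> nat \<times> nat + nat \<times> nat \<Rightarrow> 'p padic" where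
    "single i t = case_sum (\<lambda>(j, n). if n = i then t (Inl j) else 0) (\<lambda>(j, n). if n = i then t (Inr j) else 0)"
    for i t
  have slice_single: "slice n (single i t) = (if n = i then t else 0)" for n i t
    by (auto simp: slice_def single_def fun_eq_iff split: sum.split)
  have single: "single i t \<in> tensor_Zp m R" if "i < m" "t \<in> R" "zp_submodule (std_space k) R" for i t R
    using that zp_submodule_0[OF that(3)] by (auto simp: tensor_Zp_def slice_single)
  have sum_single: "(\<Sum>n<m. std_form k (slice n z) (slice n (single i t))) = std_form k (slice i z) t"
    if "i < m" for i t and z :: "nat \<times> nat + nat \<times> nat \<Rightarrow> 'p padic"
  proof -
    have "(\<Sum>n<m. std_form k (slice n z) (slice n (single i t))) =
        (\<Sum>n<m. if n = i then std_form k (slice i z) t else 0)"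
      by (rule sum.cong) (auto simp: slice_single std_form_eq_sym_form)
    then show ?thesis using that by simp
  qed
  \<comment> \<open>Integrality of \<open>e\<close> on the second summand of \<open>M\<close> puts
    each slice of \<open>y'\<close> in the dual of \<open>T\<close>, which is \<open>T\<close>. The
    first summand, pulled back by \<open>G\<close>, does the same for \<open>x'\<close> and
    \<open>Q\<close>.\<close>
  have "slice i y' \<in> T" if i: "i < m" for i
  proof (rule self_dual_std_dual[OF T vy(3)[OF i]])
    fix t assume "t \<in> T"
    from MI[OF zp_submodule_0[OF Qm] single[OF i this Ts]] have "join 0 (single i t) \<in> M" by simp
    from eM[OF this] show "std_form k (slice i y') t \<in> \<int>\<^sub>p"
      by (simp add: vy(1) sym_form_join sum_single[OF i] std_form_eq_sym_form[of \<alpha>])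
  qed
  then have y': "y' \<in> tensor_Zp m T" using vy(4) by (simp add: tensor_Zp_def)
  have "slice i x' \<in> Q" if i: "i < m" for i
  proof (rule self_dual_std_dual[OF Q ux(3)[OF i]])
    fix t assume "t \<in> Q"
    from MI[OF single[OF i this Qs] zp_submodule_0[OF Tm]] have "G (join 0 (single i t)) \<in> M" by simp
    from eM[OF this] show "std_form k (slice i x') t \<in> \<int>\<^sub>p"
      by (simp add: G_preserves_form ux(1) sym_form_join sum_single[OF i] std_form_eq_sym_form[of \<alpha>]
          flip: e'(1))
  qed
  then have x': "x' \<in> tensor_Zp m Q" using ux(4) by (simp add: tensor_Zp_def)
  have "case_sum u' v' \<in> chi_rep \<alpha> k m g Q T"
    unfolding mem_chi_rep_iff using ux(2) vy(2) x' y' e'(1)[unfolded ux(1) vy(1), symmetric] by blast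
  from dual[OF this] have "std_form \<alpha> u' u - std_form \<alpha> v' v \<in> \<int>\<^sub>p" by (simp add: dbl_form_case_sum)
  \<comment> \<open>The non-integral value at \<open>f\<close> is, up to sign, the pairing of (u',
    v') with (u, v), which \<open>dual\<close> makes integral.\<close>
  moreover have "sym_form J e f = std_form \<alpha> v' v - std_form \<alpha> u' u"
  proof -
    have "sym_form J e f = sym_form J e (join v 0) - sym_form J (G e') (G (join u 0))"
      by (simp add: f_def sym_form_diff_right e'(1))
    then show ?thesis
      by (simp add: G_preserves_form vy(1) ux(1) sym_form_join std_form_eq_sym_form)
  qed
  ultimately show False using ef padic_ints_uminus by fastforce
qed

lemma self_dual_chi_rep:
  assumes Q: "self_dual (std_space k) (std_form k) Q" and T: "self_dual (std_space k) (std_form k) T"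
  shows "self_dual (dbl_space \<alpha>) (dbl_form \<alpha>) (chi_rep \<alpha> k m g Q T)"
proof (rule self_dualI)
  have Qs: "zp_submodule (std_space k) Q" "\<And>r r'. r \<in> Q \<Longrightarrow> r' \<in> Q \<Longrightarrow> std_form k r r' \<in> \<int>\<^sub>p"
    and Ts: "zp_submodule (std_space k) T" "\<And>r r'. r \<in> T \<Longrightarrow> r' \<in> T \<Longrightarrow> std_form k r r' \<in> \<int>\<^sub>p"
    using Q T by (auto simp: self_dual_def isotropic_def)
  have "dbl_form \<alpha> w w' \<in> \<int>\<^sub>p" if "w \<in> chi_rep \<alpha> k m g Q T" "w' \<in> chi_rep \<alpha> k m g Q T" for w w'
  proof -
    from that obtain u v x y u' v' x' y' where "w = case_sum u v" "w' = case_sum u' v'"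
      and z: "x \<in> tensor_Zp m Q" "y \<in> tensor_Zp m T" "x' \<in> tensor_Zp m Q" "y' \<in> tensor_Zp m T"
      and "join v y = G (join u x)" "join v' y' = G (join u' x')"
      by (elim chi_repE)
    then have "dbl_form \<alpha> w w' =
        (\<Sum>i<m. std_form k (slice i y) (slice i y')) - (\<Sum>i<m. std_form k (slice i x) (slice i x'))"
      by (simp add: dbl_form_G)
    moreover have "std_form k (slice i y) (slice i y') \<in> \<int>\<^sub>p" "std_form k (slice i x) (slice i x') \<in> \<int>\<^sub>p"
      if "i < m" for i using that z by (auto simp: tensor_Zp_def intro: Qs(2) Ts(2))
    ultimately show ?thesis by (auto intro!: padic_ints_diff padic_ints_sum)
  qed
  then show "isotropic (dbl_space \<alpha>) (dbl_form \<alpha>) (chi_rep \<alpha> k m g Q T)"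
    using zp_submodule_chi_rep[OF Qs(1) Ts(1)] by (simp add: isotropic_def)
next
  fix z assume "z \<in> dbl_space \<alpha>" and int: "\<And>w. w \<in> chi_rep \<alpha> k m g Q T \<Longrightarrow> dbl_form \<alpha> w z \<in> \<int>\<^sub>p"
  then obtain u v where "z = case_sum u v" "u \<in> std_space \<alpha>" "v \<in> std_space \<alpha>"
    by (auto simp: dbl_space_def)
  with int show "z \<in> chi_rep \<alpha> k m g Q T" using chi_rep_dual[OF Q T] by simp
qed

text \<open>By monotonicity the value at self-dual \<open>Q0\<close>, \<open>T0\<close> inside
  \<open>Q\<close>, \<open>T\<close> is the required self-dual submodule; the bound on the form
  comes from \<open>dbl_form_G\<close>.\<close>

lemma almost_self_dual_chi_rep:
  assumes Q: "almost_self_dual (std_space k) (std_form k) Q" and T: "almost_self_dual (std_space k) (std_form k) T"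
  shows "almost_self_dual (dbl_space \<alpha>) (dbl_form \<alpha>) (chi_rep \<alpha> k m g Q T)"
proof -
  let ?P = "{z / of_nat CARD('p) | z. z \<in> (\<int>\<^sub>p :: 'p padic set)}"
  \<comment> \<open>Clearing the denominator lets the closure properties of Z_p be applied to the
    sums below.\<close>
  have P_iff: "z \<in> ?P \<longleftrightarrow> of_nat CARD('p) * z \<in> \<int>\<^sub>p" for z
  proof
    assume "of_nat CARD('p) * z \<in> \<int>\<^sub>p"
    moreover have "z = of_nat CARD('p) * z / of_nat CARD('p)" by simp
    ultimately show "z \<in> ?P" by blast
  qed auto
  have Qs: "zp_submodule (std_space k) Q" "\<And>r r'. r \<in> Q \<Longrightarrow> r' \<in> Q \<Longrightarrow> of_nat CARD('p) * std_form k r r' \<in> \<int>\<^sub>p"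
    using Q unfolding almost_self_dual_def P_iff by blast+
  have Ts: "zp_submodule (std_space k) T" "\<And>r r'. r \<in> T \<Longrightarrow> r' \<in> T \<Longrightarrow> of_nat CARD('p) * std_form k r r' \<in> \<int>\<^sub>p"
    using T unfolding almost_self_dual_def P_iff by blast+
  obtain Q0 T0 where 0: "Q0 \<subseteq> Q" "T0 \<subseteq> T"
    and "self_dual (std_space k) (std_form k) Q0" "self_dual (std_space k) (std_form k) T0"
    using Q T unfolding almost_self_dual_def by blast
  then have "self_dual (dbl_space \<alpha>) (dbl_form \<alpha>) (chi_rep \<alpha> k m g Q0 T0)"
    by (intro self_dual_chi_rep)
  with chi_rep_mono[OF 0] have "\<exists>R\<subseteq>chi_rep \<alpha> k m g Q T. self_dual (dbl_space \<alpha>) (dbl_form \<alpha>) R"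
    by blast
  moreover have "dbl_form \<alpha> w w' \<in> ?P" if "w \<in> chi_rep \<alpha> k m g Q T" "w' \<in> chi_rep \<alpha> k m g Q T" for w w'
  proof -
    from that obtain u v x y u' v' x' y' where "w = case_sum u v" "w' = case_sum u' v'"
      and z: "x \<in> tensor_Zp m Q" "y \<in> tensor_Zp m T" "x' \<in> tensor_Zp m Q" "y' \<in> tensor_Zp m T"
      and "join v y = G (join u x)" "join v' y' = G (join u' x')"
      by (elim chi_repE)
    then have "of_nat CARD('p) * dbl_form \<alpha> w w' =
        (\<Sum>i<m. of_nat CARD('p) * std_form k (slice i y) (slice i y')) -
        (\<Sum>i<m. of_nat CARD('p) * std_form k (slice i x) (slice i x'))"
      by (simp add: dbl_form_G right_diff_distrib sum_distrib_left)
    also have "\<dots> \<in> \<int>\<^sub>p"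
      using z by (intro padic_ints_diff padic_ints_sum Qs(2) Ts(2)) (auto simp: tensor_Zp_def)
    finally show ?thesis unfolding P_iff .
  qed
  ultimately show ?thesis
    unfolding almost_self_dual_def using zp_submodule_chi_rep[OF Qs(1) Ts(1)] by blast
qed

end

section \<open>From a representative to the double coset\<close>

lemma double_coset_representative:
  assumes "\<gg> \<in> double_cosets \<alpha> k"
  obtains m g where "g \<in> \<gg>" "g \<in> GL_fin \<alpha> k m"
proof -
  obtain g0 where g0: "g0 \<in> carrier (GL_inf \<alpha> k)"
    and \<gg>: "\<gg> = (K_sub k #>\<^bsub>GL_inf \<alpha> k\<^esub> g0) <#>\<^bsub>GL_inf \<alpha> k\<^esub> K_sub k"
    using assms by (auto simp: double_cosets_def)
  \<comment> \<open>The identity matrix shows that \<open>K_sub k\<close> is nonempty; any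
    \<open>h\<close> in it then gives the representative \<open>h\<close> \<open>g0\<close>
    \<open>h\<close>.\<close>
  have "(kron :: nat \<Rightarrow> nat \<Rightarrow> 'a padic) \<in> O_inf"
    by (auto simp: O_inf_def nontriv_entries_def mat_mult_kron_left) (simp add: kron_def)
  then obtain h :: "idx \<Rightarrow> idx \<Rightarrow> 'a padic" where h: "h \<in> K_sub k" by (auto simp: K_sub_def)
  interpret Group.group "GL_inf \<alpha> k :: (idx \<Rightarrow> idx \<Rightarrow> 'a padic) monoid" by (rule group_GL_inf)
  let ?g = "h \<otimes>\<^bsub>GL_inf \<alpha> k\<^esub> g0 \<otimes>\<^bsub>GL_inf \<alpha> k\<^esub> h"
  have "?g \<in> \<gg>" using h by (auto simp: \<gg> r_coset_def set_mult_def)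
  moreover have "?g \<in> carrier (GL_inf \<alpha> k)"
    using K_sub_GL[OF h, of \<alpha>] g0 by (intro m_closed)
  ultimately show thesis using GL_fin_ex that by blast
qed

theorem theorem4p13:
  fixes \<gg> :: "(idx \<Rightarrow> idx \<Rightarrow> 'p::prime_card padic) set"
    and \<alpha> k :: nat
  assumes "k \<ge> 1"
    and "\<gg> \<in> double_cosets \<alpha> k"
  shows "graph_morphism (graph_HH k) (graph_VV \<alpha>) (\<lambda>(Q, T). chi \<alpha> k \<gg> Q T)"
proof -
  obtain m g where g: "g \<in> \<gg>" "g \<in> GL_fin \<alpha> k m"
    using double_coset_representative[OF assms(2)] .
  interpret char_fun \<alpha> k m g by (rule char_fun.intro) (rule g(2))
  let ?W = "{R. almost_self_dual (std_space k) (std_form k) R} :: (nat + nat \<Rightarrow> 'p padic) set set"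
  \<comment> \<open>One representative serves all vertices at once, so monotonicity of
    \<open>chi_rep\<close> sends each arrow to an arrow or to an equality.\<close>
  have chi: "chi \<alpha> k \<gg> Q T = chi_rep \<alpha> k m g Q T" if "Q \<in> ?W" "T \<in> ?W" for Q T
    using that by (intro chi_eq_chi_rep[OF assms(2) g]) (auto simp: almost_self_dual_def)
  show ?thesis
    unfolding graph_morphism_def graph_HH_def graph_VV_def Let_def
    using almost_self_dual_chi_rep chi_rep_mono by (auto simp: chi)
qed

end
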